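(* Let $n\ge 2$ and $m\ge 1$. Let $f=f_{i_1\cdots i_m}\,dx^{i_1}\otimes\cdots\otimes dx^{i_m}$ be a symmetric tensor field of order $m$ on $\mathbb{T}^n$ with coefficients in $\mathcal{T}'$. Then $R^mf=0$ (where $R^mf$ is defined by duality) if and only if there is a tensor field $h$ of order $m-1$ on $\mathbb{T}^n$ with coefficients in $\mathcal{T}'$ such that $f=\sigma\nabla h$, where $\nabla$ is the Levi-Civita connection and $\sigma$ is symmetrization. Furthermore, if for some $s\in\mathbb{R}$ we have $f\in H^s(\mathbb{T}^n)$ and $R^mf=0$, then the tensor field $h$ can be chosen to be in $H^{s+1}(\mathbb{T}^n)$.
   Context: $\mathbb{T}^n=\mathbb{R}^n/\mathbb{Z}^n$ is the standard flat torus; $\mathcal{T}=C^\infty(\mathbb{T}^n)$ (complex-valued) and $\mathcal{T}'$ is its dual, the space of distributions on $\mathbb{T}^n$; $\langle\cdot,\cdot\rangle$ is the bilinear duality pairing extending $\int_{\mathbb{T}^n}f\eta\,dx$. Repeated indices are summed. A tensor field $f$ is symmetric if its components $f_{i_1\cdots i_m}$ are invariant under permutations of the indices; a tensor field belongs to a function (or distribution) space if each of its components does. Tensor fields of order $0$ are scalar functions (or distributions). For a tensor field $f$ of order $m$ and $\xi\in\mathbb{R}^n$, write $f(x,\xi)=f_{i_1\cdots i_m}(x)\xi^{i_1}\cdots\xi^{i_m}$. For smooth $f$, its Radon (X-ray) transform is $R^mf(x,v)=\int_0^1f(x+tv,v)\,dt$ for $x\in\mathbb{T}^n$, $v\in\mathbb{Z}^n\setminus\{0\}$.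 For $f$ with coefficients in $\mathcal{T}'$ and $v\in\mathbb{Z}^n\setminus\{0\}$, $R^mf(\cdot,v)\in\mathcal{T}'$ is defined by $\langle R^mf(\cdot,v),\eta\rangle=\langle f(\cdot,v),R\eta(\cdot,v)\rangle$ for all scalar $\eta\in\mathcal{T}$, where $R\eta(x,v)=\int_0^1\eta(x+tv)\,dt$. $R^mf=0$ means $R^mf(\cdot,v)=0$ for all $v\in\mathbb{Z}^n\setminus\{0\}$. On the flat torus $(\nabla h)_{i_1\cdots i_m}=\partial_{i_1}h_{i_2\cdots i_m}$ (distributional derivatives), and $\sigma$ averages over all permutations of the $m$ indices. $H^s=H^s(\mathbb{T}^n)\subset\mathcal{T}'$ is the Sobolev space with norm $\|f\|_{H^s}=\big(\sum_{k\in\mathbb{Z}^n}(1+|k|^2)^s|\hat f(k)|^2\big)^{1/2}$, where $\hat f(k)=\langle f,e_{-k}\rangle$ and $e_k(x)=\exp(2\pi ik\cdot x)$. *)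

theory Defs
  imports "HOL-Analysis.Analysis" "HOL-Combinatorics.Permutations"
begin

section \<open>Test functions on the torus\<close>

text \<open>
  Functions on the torus \<open>\<real>\<^sup>n / \<int>\<^sup>n\<close> are represented by \<open>\<int>\<^sup>n\<close>-periodic functions on \<open>\<real>\<^sup>n\<close>,
  where \<open>n = CARD('n)\<close>. Smoothness means that all iterated partial derivatives are (totally)
  differentiable everywhere.
\<close>

definition int_lattice :: "(real^'n) set" where
  "int_lattice = {k. \<forall>i. k $ i \<in> \<int>}"

definition pdiff :: "'n::finite \<Rightarrow> (real^'n \<Rightarrow> complex) \<Rightarrow> real^'n \<Rightarrow> complex" where
  "pdiff i \<phi> x = frechet_derivative \<phi> (at x) (axis i 1)"

definition pdiffs :: "'n::finite list \<Rightarrow> (real^'n \<Rightarrow> complex) \<Rightarrow> real^'n \<Rightarrow> complex" where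
  "pdiffs \<alpha> \<phi> = foldr pdiff \<alpha> \<phi>"

definition test_functions :: "(real^'n::finite \<Rightarrow> complex) set" where
  "test_functions =
     {\<phi>. (\<forall>x. \<forall>k\<in>int_lattice. \<phi> (x + k) = \<phi> x) \<and> (\<forall>\<alpha> x. pdiffs \<alpha> \<phi> differentiable (at x))}"

text \<open>
  The Frechet topology on the test functions: uniform convergence of all derivatives.
\<close>

definition test_nbhd ::
    "nat \<Rightarrow> real \<Rightarrow> (real^'n::finite \<Rightarrow> complex) \<Rightarrow> (real^'n \<Rightarrow> complex) set" where
  "test_nbhd N e \<phi> =
     {\<psi>\<in>test_functions. \<forall>\<alpha> x. length \<alpha> \<le> N \<longrightarrow> norm (pdiffs \<alpha> \<psi> x - pdiffs \<alpha> \<phi> x) < e}"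

definition test_topology :: "(real^'n::finite \<Rightarrow> complex) topology" where
  "test_topology =
     topology (\<lambda>U. U \<subseteq> test_functions \<and> (\<forall>\<phi>\<in>U. \<exists>N. \<exists>e>0. test_nbhd N e \<phi> \<subseteq> U))"

lemma test_nbhd_mono:
  assumes "N \<le> M" "d \<le> e"
  shows "test_nbhd M d \<phi> \<subseteq> test_nbhd N e \<phi>"
  using assms unfolding test_nbhd_def
  by (intro Collect_mono) (meson order_less_le_trans order_trans)

lemma istopology_test:
  "istopology (\<lambda>U. U \<subseteq> (test_functions :: (real^'n::finite \<Rightarrow> complex) set) \<and>
     (\<forall>\<phi>\<in>U. \<exists>N. \<exists>e>0. test_nbhd N e \<phi> \<subseteq> U))"
proof -
  have "\<exists>N. \<exists>e>0. test_nbhd N e \<phi> \<subseteq> S \<inter> T"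
    if "\<exists>N. \<exists>e>0. test_nbhd N e \<phi> \<subseteq> S" "\<exists>N. \<exists>e>0. test_nbhd N e \<phi> \<subseteq> T"
    for S T and \<phi> :: "real^'n \<Rightarrow> complex"
  proof -
    from that obtain N M d e where *: "d > 0" "e > 0"
      "test_nbhd N d \<phi> \<subseteq> S" "test_nbhd M e \<phi> \<subseteq> T"
      by blast
    have "test_nbhd (max N M) (min d e) \<phi> \<subseteq> S \<inter> T"
      using *(3,4) test_nbhd_mono[of N "max N M" "min d e" d \<phi>]
        test_nbhd_mono[of M "max N M" "min d e" e \<phi>] by auto
    moreover have "min d e > 0" using * by simp
    ultimately show ?thesis by blast
  qed
  then show ?thesis
    unfolding istopology_def
  proof (intro conjI allI impI ballI, goal_cases)
    case (1 S T)
    then show ?case by blast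
  next
    case (2 S T \<phi>)
    from 2(2,3,4) have "\<exists>N. \<exists>e>0. test_nbhd N e \<phi> \<subseteq> S" "\<exists>N. \<exists>e>0. test_nbhd N e \<phi> \<subseteq> T"
      by simp_all
    then show ?case by (rule 2(1))
  next
    case (3 \<K>)
    then show ?case by blast
  next
    case (4 \<K> \<phi>)
    from 4(3) obtain K where K: "K \<in> \<K>" "\<phi> \<in> K" by blast
    with 4(2) obtain N e where "e > 0" "test_nbhd N e \<phi> \<subseteq> K" by blast
    with K(1) show ?case by blast
  qed
qed

lemma openin_test_topology:
  "openin test_topology U \<longleftrightarrow>
     U \<subseteq> test_functions \<and> (\<forall>\<phi>\<in>U. \<exists>N. \<exists>e>0. test_nbhd N e \<phi> \<subseteq> U)"
  unfolding test_topology_def by (subst topology_inverse'[OF istopology_test]) simp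

lemma topspace_test_topology [simp]: "topspace test_topology = test_functions"
proof -
  have "openin test_topology test_functions"
    unfolding openin_test_topology by (auto simp: test_nbhd_def intro!: exI[of _ 1])
  then show ?thesis
    by (meson openin_subset openin_test_topology openin_topspace subset_antisym)
qed


section \<open>Distributions\<close>

text \<open>
  A distribution is a functional on the test functions; its values at other arguments are
  irrelevant and never used.
\<close>

type_synonym 'n distr = "(real^'n \<Rightarrow> complex) \<Rightarrow> complex"

definition distributions :: "'n::finite distr set" where
  "distributions =
     {u. (\<forall>\<phi>\<in>test_functions. \<forall>\<psi>\<in>test_functions. u (\<lambda>x. \<phi> x + \<psi> x) = u \<phi> + u \<psi>) \<and>
         (\<forall>c. \<forall>\<phi>\<in>test_functions. u (\<lambda>x. c * \<phi> x) = c * u \<phi>) \<and>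
         continuous_map test_topology euclidean u}"

definition distr_deriv :: "'n::finite \<Rightarrow> 'n distr \<Rightarrow> 'n distr" where
  "distr_deriv i u = (\<lambda>\<phi>. - u (pdiff i \<phi>))"

definition torus_exp :: "real^'n::finite \<Rightarrow> real^'n \<Rightarrow> complex" where
  "torus_exp k = (\<lambda>x. exp (2 * of_real pi * \<i> * of_real (k \<bullet> x)))"

definition fourier_coeff :: "'n::finite distr \<Rightarrow> real^'n \<Rightarrow> complex" where
  "fourier_coeff u k = u (torus_exp (- k))"

definition sobolev :: "real \<Rightarrow> 'n::finite distr set" where
  "sobolev s =
     {u\<in>distributions.
        (\<lambda>k. (1 + (norm k)\<^sup>2) powr s * (norm (fourier_coeff u k))\<^sup>2) summable_on int_lattice}"


section \<open>Tensor fields\<close>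

text \<open>
  A tensor field of order \<open>m\<close> is given by its components, indexed by the lists \<open>[i\<^sub>1, \<dots>, i\<^sub>m]\<close> of
  length \<open>m\<close>. Components at lists of other lengths are irrelevant.
\<close>

type_synonym 'n tensor = "'n list \<Rightarrow> 'n distr"

definition tensor_in :: "nat \<Rightarrow> 'n::finite distr set \<Rightarrow> 'n tensor \<Rightarrow> bool" where
  "tensor_in m A f \<longleftrightarrow> (\<forall>I. length I = m \<longrightarrow> f I \<in> A)"

definition tensor_eq :: "nat \<Rightarrow> 'n::finite tensor \<Rightarrow> 'n tensor \<Rightarrow> bool" where
  "tensor_eq m f g \<longleftrightarrow> (\<forall>I. length I = m \<longrightarrow> (\<forall>\<phi>\<in>test_functions. f I \<phi> = g I \<phi>))"

definition symmetric_tensor :: "nat \<Rightarrow> 'n::finite tensor \<Rightarrow> bool" where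
  "symmetric_tensor m f \<longleftrightarrow>
     (\<forall>p. p permutes {..<m} \<longrightarrow> tensor_eq m (\<lambda>I. f (permute_list p I)) f)"

definition symmetrize :: "nat \<Rightarrow> 'n::finite tensor \<Rightarrow> 'n tensor" where
  "symmetrize m f = (\<lambda>I \<phi>. (\<Sum>p | p permutes {..<m}. f (permute_list p I) \<phi>) / fact m)"

text \<open>
  On the flat torus the Christoffel symbols vanish, so the Levi-Civita connection is
  \<open>(\<nabla>h) [i\<^sub>1, \<dots>, i\<^sub>m] = \<partial> i\<^sub>1 (h [i\<^sub>2, \<dots>, i\<^sub>m])\<close>.
\<close>

definition nabla :: "'n::finite tensor \<Rightarrow> 'n tensor" where
  "nabla h = (\<lambda>I. distr_deriv (hd I) (h (tl I)))"

definition tensor_apply :: "nat \<Rightarrow> 'n::finite tensor \<Rightarrow> real^'n \<Rightarrow> 'n distr" where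
  "tensor_apply m f v =
     (\<lambda>\<phi>. \<Sum>I | length I = m. f I \<phi> * of_real (prod_list (map (\<lambda>i. v $ i) I)))"


section \<open>The Radon transform\<close>

text \<open>
  The transform \<open>radon_test\<close> of test functions is used to define the transform \<open>radon\<close> of
  distributional tensor fields by duality; the pairing is bilinear, not sesquilinear.
\<close>

definition radon_test :: "(real^'n::finite \<Rightarrow> complex) \<Rightarrow> real^'n \<Rightarrow> real^'n \<Rightarrow> complex" where
  "radon_test \<eta> v = (\<lambda>x. integral {0..1} (\<lambda>t. \<eta> (x + t *\<^sub>R v)))"

definition radon :: "nat \<Rightarrow> 'n::finite tensor \<Rightarrow> real^'n \<Rightarrow> 'n distr" where
  "radon m f v = (\<lambda>\<eta>. tensor_apply m f v (radon_test \<eta> v))"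

definition radon_zero :: "nat \<Rightarrow> 'n::finite tensor \<Rightarrow> bool" where
  "radon_zero m f \<longleftrightarrow> (\<forall>v\<in>int_lattice - {0}. \<forall>\<eta>\<in>test_functions. radon m f v \<eta> = 0)"

end

theory Submission
  imports Defs
begin

text \<open>
  A distribution on the torus is determined by its Fourier coefficients, and these turn the problem
  into algebra for each frequency \<open>k\<close> separately. Pairing \<open>R\<^sup>m f(\<cdot>, v)\<close> with the exponential
  \<open>torus_exp (-k)\<close> gives zero unless \<open>k \<bullet> v = 0\<close>, and then it gives the value of the symmetric tensor
  \<open>F\<close> of Fourier coefficients of \<open>f\<close> at \<open>k\<close> on \<open>(v, \<dots>, v)\<close>. So \<open>R\<^sup>m f = 0\<close> says that \<open>F\<close> vanishes on
  \<open>(v, \<dots>, v)\<close> for all integer vectors \<open>v\<close> orthogonal to \<open>k\<close>, whereas \<open>f = \<sigma>\<nabla>h\<close> says that \<open>F\<close> is the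
  symmetrization of \<open>k \<otimes> H\<close>, where \<open>H\<close> is \<open>2\<pi>i\<close> times the tensor of coefficients of \<open>h\<close>.

  If \<open>F\<close> vanishes on the diagonal of the lattice orthogonal to \<open>k\<close>, then by \<open>polarization\<close> it vanishes
  on all tuples of vectors from this lattice. For \<open>k = 0\<close> this means \<open>F = 0\<close>. For \<open>k \<noteq> 0\<close> the lattice
  contains the vectors \<open>\<bar>k\<bar>\<^sup>2 e\<^sub>i - k\<^sub>i k\<close>, the multiples by \<open>\<bar>k\<bar>\<^sup>2\<close> of the projections of the basis vectors
  \<open>e\<^sub>i\<close>. Replacing the arguments of \<open>F(e\<^sub>i, e\<^sub>j, \<dots>)\<close> by their projections one after the other leads to
  zero, and each replacement changes the value by \<open>k\<^sub>i\<close> times a component of a tensor with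
  an argument \<open>k\<close>. Up to the order of the indices, which symmetrization forgets, this writes \<open>F\<close> as
  \<open>k \<otimes> H\<close> with \<open>H\<close> given by an explicit formula (\<open>quotient_works\<close>). The formula shows that the
  components of \<open>H\<close> are at most a constant times \<open>\<Sum> \<bar>F\<bar> / \<bar>k\<bar>\<close> (\<open>norm_quotient_le\<close>). Hence the
  coefficients of \<open>h\<close> grow at most polynomially, which makes \<open>h\<close> a distribution
  (\<open>distribution_with_fourier_coeffs\<close>), and one Sobolev derivative is gained (\<open>sobolev_gain\<close>).

  Conversely, \<open>R\<^sup>m(\<sigma>\<nabla>h)(\<cdot>, v)\<close> applied to \<open>\<eta>\<close> pairs components of \<open>h\<close> with the derivative of \<open>R\<eta>(\<cdot>, v)\<close> in
  direction \<open>v\<close>, and this derivative is zero because \<open>R\<eta>(\<cdot>, v)\<close> is an average over closed lines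
  (\<open>radon_zero_symmetrize_nabla\<close>).

  The Fourier analysis rests on one operation, the weighted average \<open>line_avg\<close> along a closed line.
  It maps test functions to test functions and commutes with derivatives. Iterated
  over the coordinate directions with exponential weights it isolates a Fourier mode, and with
  Fejer kernels as weights it approximates the identity by combinations of such modes. The latter
  yields that a distribution with vanishing Fourier coefficients is zero
  (\<open>distribution_zero_if_fourier_coeffs_zero\<close>).
\<close>

section \<open>Test functions and their derivatives\<close>

lemma pdiffs_Nil [simp]: "pdiffs [] \<phi> = \<phi>"
  by (simp add: pdiffs_def)

lemma pdiffs_Cons [simp]: "pdiffs (i # \<alpha>) \<phi> = pdiff i (pdiffs \<alpha> \<phi>)"
  by (simp add: pdiffs_def)

lemma pdiffs_append: "pdiffs (\<alpha> @ \<beta>) \<phi> = pdiffs \<alpha> (pdiffs \<beta> \<phi>)"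
  by (simp add: pdiffs_def)

lemma pdiff_eqI:
  assumes "(\<phi> has_derivative D) (at x)"
  shows "pdiff i \<phi> x = D (axis i 1)"
  using frechet_derivative_at[OF assms] by (simp add: pdiff_def)

lemma has_derivative_pdiff:
  fixes \<phi> :: "real^'n::finite \<Rightarrow> complex"
  assumes "\<phi> differentiable (at x)"
  shows "(\<phi> has_derivative (\<lambda>h. \<Sum>i\<in>UNIV. of_real (h $ i) * pdiff i \<phi> x)) (at x)"
proof -
  let ?D = "frechet_derivative \<phi> (at x)"
  have D: "(\<phi> has_derivative ?D) (at x)"
    using assms by (simp add: frechet_derivative_works)
  then have lin: "linear ?D" by (rule has_derivative_linear)
  have "?D h = (\<Sum>i\<in>UNIV. of_real (h $ i) * pdiff i \<phi> x)" for h
  proof -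
    have "h = (\<Sum>i\<in>UNIV. (h $ i) *\<^sub>R axis i 1)"
      using basis_expansion[of h] by (simp add: scalar_mult_eq_scaleR)
    then have "?D h = ?D (\<Sum>i\<in>UNIV. (h $ i) *\<^sub>R axis i 1)" by simp
    also have "\<dots> = (\<Sum>i\<in>UNIV. (h $ i) *\<^sub>R ?D (axis i 1))"
      by (simp add: linear_sum[OF lin] linear_cmul[OF lin])
    finally show ?thesis by (simp add: pdiff_def scaleR_conv_of_real)
  qed
  then have "?D = (\<lambda>h. \<Sum>i\<in>UNIV. of_real (h $ i) * pdiff i \<phi> x)" by (rule ext)
  with D show ?thesis by simp
qed

lemma has_vector_derivative_along_line:
  fixes \<phi> :: "real^'n::finite \<Rightarrow> complex"
  assumes "\<And>x. \<phi> differentiable (at x)"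
  shows "((\<lambda>t. \<phi> (x + t *\<^sub>R v)) has_vector_derivative
           (\<Sum>i\<in>UNIV. of_real (v $ i) * pdiff i \<phi> (x + t *\<^sub>R v))) (at t within S)"
proof -
  have "((\<lambda>t. \<phi> (x + t *\<^sub>R v)) has_derivative
      (\<lambda>h. \<Sum>i\<in>UNIV. of_real ((h *\<^sub>R v) $ i) * pdiff i \<phi> (x + t *\<^sub>R v))) (at t within S)"
    by (rule has_derivative_compose[OF _ has_derivative_pdiff[OF assms], of "\<lambda>t. x + t *\<^sub>R v"])
      (auto intro!: derivative_eq_intros)
  then show ?thesis
    unfolding has_vector_derivative_def
    by (rule back_subst[of "\<lambda>d. (_ has_derivative d) _"])
      (auto simp: fun_eq_iff scaleR_conv_of_real[of _ "_ :: complex"] sum_distrib_left mult.assoc)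
qed

lemma test_periodic: "\<phi> \<in> test_functions \<Longrightarrow> k \<in> int_lattice \<Longrightarrow> \<phi> (x + k) = \<phi> x"
  and test_pdiffs_differentiable: "\<phi> \<in> test_functions \<Longrightarrow> pdiffs \<alpha> \<phi> differentiable (at x)"
  by (auto simp: test_functions_def)

lemma test_differentiable: "\<phi> \<in> test_functions \<Longrightarrow> \<phi> differentiable (at x)"
  using test_pdiffs_differentiable[of \<phi> "[]"] by simp

lemma test_continuous: "\<phi> \<in> test_functions \<Longrightarrow> continuous_on S \<phi>"
  by (meson continuous_at_imp_continuous_on differentiable_imp_continuous_within
      test_differentiable)

lemma test_functionI:
  assumes "\<And>x k. k \<in> int_lattice \<Longrightarrow> \<phi> (x + k) = \<phi> x"
    and "\<And>\<alpha> x. pdiffs \<alpha> \<phi> differentiable (at x)"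
  shows "\<phi> \<in> test_functions"
  using assms by (auto simp: test_functions_def)

lemma pdiff_test [simp]:
  assumes "\<phi> \<in> test_functions"
  shows "pdiff i \<phi> \<in> test_functions"
proof (rule test_functionI)
  fix x k :: "real^'a" assume k: "k \<in> int_lattice"
  let ?D = "\<lambda>h. \<Sum>i\<in>UNIV. of_real (h $ i) * pdiff i \<phi> (x + k)"
  have "((\<lambda>y. \<phi> (y + k)) has_derivative ?D) (at x)"
    by (rule has_derivative_compose[OF _ has_derivative_pdiff[OF test_differentiable[OF assms]]])
      (auto intro!: derivative_eq_intros)
  then have "(\<phi> has_derivative ?D) (at x)"
    using test_periodic[OF assms k] by simp
  then have "pdiff i \<phi> x = ?D (axis i 1)" by (rule pdiff_eqI)
  also have "\<dots> = pdiff i \<phi> (x + k)"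
    by (simp add: axis_def if_distrib if_distribR cong: if_cong)
  finally show "pdiff i \<phi> (x + k) = pdiff i \<phi> x" ..
next
  fix \<alpha> x
  show "pdiffs \<alpha> (pdiff i \<phi>) differentiable (at x)"
    using test_pdiffs_differentiable[OF assms, of "\<alpha> @ [i]"] by (simp add: pdiffs_append)
qed

lemma pdiffs_test [simp]: "\<phi> \<in> test_functions \<Longrightarrow> pdiffs \<alpha> \<phi> \<in> test_functions"
  by (induction \<alpha>) auto

lemma pdiff_lincomb:
  assumes "\<phi> differentiable (at x)" "\<psi> differentiable (at x)"
  shows "pdiff i (\<lambda>x. a * \<phi> x + b * \<psi> x) x = a * pdiff i \<phi> x + b * pdiff i \<psi> x"
proof -
  have "((\<lambda>x. a * \<phi> x + b * \<psi> x) has_derivative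
      (\<lambda>h. a * frechet_derivative \<phi> (at x) h + b * frechet_derivative \<psi> (at x) h)) (at x)"
    using assms by (auto intro!: derivative_eq_intros simp: frechet_derivative_works)
  from pdiff_eqI[OF this] show ?thesis by (simp add: pdiff_def)
qed

lemma pdiffs_lincomb:
  assumes "\<phi> \<in> test_functions" "\<psi> \<in> test_functions"
  shows "pdiffs \<alpha> (\<lambda>x. a * \<phi> x + b * \<psi> x) = (\<lambda>x. a * pdiffs \<alpha> \<phi> x + b * pdiffs \<alpha> \<psi> x)"
proof (induction \<alpha>)
  case (Cons i \<alpha>)
  then show ?case
    using assms by (auto simp: pdiff_lincomb test_differentiable)
qed simp

lemma test_lincomb:
  assumes "\<phi> \<in> test_functions" "\<psi> \<in> test_functions"
  shows "(\<lambda>x. a * \<phi> x + b * \<psi> x) \<in> test_functions"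
  using assms
  by (intro test_functionI) (auto simp: pdiffs_lincomb test_periodic test_differentiable)

lemma test_add: "\<phi> \<in> test_functions \<Longrightarrow> \<psi> \<in> test_functions \<Longrightarrow> (\<lambda>x. \<phi> x + \<psi> x) \<in> test_functions"
  and test_diff: "\<phi> \<in> test_functions \<Longrightarrow> \<psi> \<in> test_functions \<Longrightarrow> (\<lambda>x. \<phi> x - \<psi> x) \<in> test_functions"
  and test_scale: "\<phi> \<in> test_functions \<Longrightarrow> (\<lambda>x. c * \<phi> x) \<in> test_functions"
  using test_lincomb[of \<phi> \<psi> 1 1] test_lincomb[of \<phi> \<psi> 1 "-1"] test_lincomb[of \<phi> \<phi> c 0] by simp_all

lemma pdiffs_diff: "\<phi> \<in> test_functions \<Longrightarrow> \<psi> \<in> test_functions \<Longrightarrow>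
    pdiffs \<alpha> (\<lambda>x. \<phi> x - \<psi> x) = (\<lambda>x. pdiffs \<alpha> \<phi> x - pdiffs \<alpha> \<psi> x)"
  and pdiffs_scale: "\<phi> \<in> test_functions \<Longrightarrow> pdiffs \<alpha> (\<lambda>x. c * \<phi> x) = (\<lambda>x. c * pdiffs \<alpha> \<phi> x)"
  using pdiffs_lincomb[of \<phi> \<psi> \<alpha> 1 "-1"] pdiffs_lincomb[of \<phi> \<phi> \<alpha> c 0] by simp_all

lemma pdiff_const: "pdiff i (\<lambda>x. c) = (\<lambda>x. 0)"
  by (rule ext, subst pdiff_eqI[OF has_derivative_const]) simp

lemma pdiffs_zero: "pdiffs \<alpha> (\<lambda>x. 0) = (\<lambda>x. 0)"
  by (induction \<alpha>) (auto simp: pdiff_const)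

lemma test_zero: "(\<lambda>x. 0) \<in> test_functions"
  by (rule test_functionI) (auto simp: pdiffs_zero)

lemma test_sum:
  assumes "\<And>a. a \<in> A \<Longrightarrow> \<phi> a \<in> test_functions"
  shows "(\<lambda>x. \<Sum>a\<in>A. \<phi> a x) \<in> test_functions"
  using assms by (induction A rule: infinite_finite_induct) (auto intro: test_zero test_add)

text \<open>
  Upper bounds for the seminorms that define the topology of the test functions. Working with bounds
  instead of suprema avoids finiteness side conditions.
\<close>

definition derivs_bounded :: "nat \<Rightarrow> real \<Rightarrow> (real^'n::finite \<Rightarrow> complex) \<Rightarrow> bool" where
  "derivs_bounded N B \<phi> \<longleftrightarrow> (\<forall>\<alpha> x. length \<alpha> \<le> N \<longrightarrow> norm (pdiffs \<alpha> \<phi> x) \<le> B)"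

text \<open>
  Every point is a lattice translate of a point of the compact unit cube.
\<close>

lemma periodic_continuous_bounded:
  fixes \<phi> :: "real^'n::finite \<Rightarrow> complex"
  assumes "\<And>x k. k \<in> int_lattice \<Longrightarrow> \<phi> (x + k) = \<phi> x" and "continuous_on UNIV \<phi>"
  obtains B where "\<And>x. norm (\<phi> x) \<le> B"
proof -
  have "compact (\<phi> ` cbox 0 1)"
    using assms(2) by (intro compact_continuous_image compact_cbox) (rule continuous_on_subset, auto)
  then obtain B where B: "norm y \<le> B" if "y \<in> \<phi> ` cbox 0 1" for y
    by (meson bounded_iff compact_imp_bounded)
  have "norm (\<phi> x) \<le> B" for x
  proof -
    define k :: "real^'n" where "k = (\<chi> i. - of_int \<lfloor>x $ i\<rfloor>)"
    have "k \<in> int_lattice" by (simp add: k_def int_lattice_def)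
    then have "\<phi> (x + k) = \<phi> x" by (rule assms(1))
    moreover have "x + k \<in> cbox 0 1"
      by (auto simp: mem_box_cart k_def) linarith
    ultimately show ?thesis using B by (metis imageI)
  qed
  then show ?thesis by (rule that)
qed

lemma test_derivs_bounded:
  fixes \<phi> :: "real^'n::finite \<Rightarrow> complex"
  assumes "\<phi> \<in> test_functions"
  obtains B where "B > 0" "derivs_bounded N B \<phi>"
proof -
  have "\<exists>B. \<forall>x. norm (pdiffs \<alpha> \<phi> x) \<le> B" for \<alpha>
    using periodic_continuous_bounded[of "pdiffs \<alpha> \<phi>"] assms
    by (metis pdiffs_test test_continuous test_periodic)
  then obtain B where B: "\<And>\<alpha> x. norm (pdiffs \<alpha> \<phi> x) \<le> B \<alpha>" by metis
  let ?L = "{\<alpha> :: 'n list. set \<alpha> \<subseteq> UNIV \<and> length \<alpha> \<le> N}"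
  have fin: "finite ?L" by (rule finite_lists_length_le) simp
  have "norm (pdiffs \<alpha> \<phi> x) \<le> 1 + (\<Sum>\<alpha>\<in>?L. \<bar>B \<alpha>\<bar>)" if "length \<alpha> \<le> N" for \<alpha> x
  proof -
    have "\<bar>B \<alpha>\<bar> \<le> (\<Sum>\<alpha>\<in>?L. \<bar>B \<alpha>\<bar>)"
      using that by (intro member_le_sum[OF _ _ fin]) auto
    with B[of \<alpha> x] show ?thesis by linarith
  qed
  moreover have "1 + (\<Sum>\<alpha>\<in>?L. \<bar>B \<alpha>\<bar>) > 0"
    by (intro add_pos_nonneg sum_nonneg) auto
  ultimately show ?thesis by (intro that) (auto simp: derivs_bounded_def)
qed

section \<open>Distributions as functionals of finite order\<close>

lemma test_nbhd_iff:
  assumes "\<phi> \<in> test_functions"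
  shows "\<psi> \<in> test_nbhd N e \<phi> \<longleftrightarrow> \<psi> \<in> test_functions \<and>
     (\<forall>\<alpha> x. length \<alpha> \<le> N \<longrightarrow> norm (pdiffs \<alpha> (\<lambda>x. \<psi> x - \<phi> x) x) < e)"
  using assms by (auto simp: test_nbhd_def pdiffs_diff)

lemma distribution_add:
    "u \<in> distributions \<Longrightarrow> \<phi> \<in> test_functions \<Longrightarrow> \<psi> \<in> test_functions \<Longrightarrow>
       u (\<lambda>x. \<phi> x + \<psi> x) = u \<phi> + u \<psi>"
  and distribution_scale:
    "u \<in> distributions \<Longrightarrow> \<phi> \<in> test_functions \<Longrightarrow> u (\<lambda>x. c * \<phi> x) = c * u \<phi>"
  by (simp_all add: distributions_def)

lemma distribution_zero: "u \<in> distributions \<Longrightarrow> u (\<lambda>x. 0) = 0"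
  using distribution_scale[of u "\<lambda>x. 0" 0] test_zero by simp

lemma distribution_diff:
  assumes "u \<in> distributions" "\<phi> \<in> test_functions" "\<psi> \<in> test_functions"
  shows "u (\<lambda>x. \<phi> x - \<psi> x) = u \<phi> - u \<psi>"
  using distribution_add[OF assms(1,2) test_scale[OF assms(3), of "-1"]]
    distribution_scale[OF assms(1,3), of "-1"] by simp

lemma distribution_sum:
  assumes u: "u \<in> distributions" and "\<And>a. a \<in> A \<Longrightarrow> \<phi> a \<in> test_functions"
  shows "u (\<lambda>x. \<Sum>a\<in>A. \<phi> a x) = (\<Sum>a\<in>A. u (\<phi> a))"
  using assms(2)
  by (induction A rule: infinite_finite_induct)
    (simp_all add: distribution_zero[OF u] distribution_add[OF u] test_sum)

text \<open>
  A neighbourhood of zero is mapped into the unit ball, and every test function can be scaled into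
  this neighbourhood.
\<close>

lemma distribution_finite_order:
  assumes u: "u \<in> distributions"
  obtains N C where "C > 0"
    "\<forall>\<phi>\<in>test_functions. \<forall>B>0. derivs_bounded N B \<phi> \<longrightarrow> norm (u \<phi>) \<le> C * B"
proof -
  let ?U = "{\<phi> \<in> topspace test_topology. u \<phi> \<in> ball 0 1}"
  have "openin test_topology ?U"
    using u by (intro openin_continuous_map_preimage[of _ euclidean]) (auto simp: distributions_def)
  moreover have "(\<lambda>x. 0) \<in> ?U"
    by (simp add: distribution_zero[OF u] test_zero)
  ultimately obtain N e where e: "e > 0" "test_nbhd N e (\<lambda>x. 0) \<subseteq> ?U"
    unfolding openin_test_topology by blast
  have "norm (u \<phi>) \<le> 2 / e * B"
    if \<phi>: "\<phi> \<in> test_functions" and B: "B > 0" "derivs_bounded N B \<phi>" for \<phi> B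
  proof -
    define c where "c = e / (2 * B)"
    have c: "c > 0" using e B by (simp add: c_def)
    have "norm (of_real c * pdiffs \<alpha> \<phi> x) < e" if "length \<alpha> \<le> N" for \<alpha> x
    proof -
      have "norm (pdiffs \<alpha> \<phi> x) \<le> B" using B(2) that by (simp add: derivs_bounded_def)
      then have "c * norm (pdiffs \<alpha> \<phi> x) \<le> c * B" using c by simp
      also have "\<dots> < e" using e(1) B by (simp add: c_def)
      finally show ?thesis using c by (simp add: norm_mult)
    qed
    then have "(\<lambda>x. of_real c * \<phi> x) \<in> test_nbhd N e (\<lambda>x. 0)"
      using \<phi> by (simp add: test_nbhd_iff test_zero test_scale pdiffs_scale)
    with e(2) have "norm (u (\<lambda>x. of_real c * \<phi> x)) < 1" by auto
    then have "c * norm (u \<phi>) < 1"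
      using c by (simp add: distribution_scale[OF u \<phi>] norm_mult)
    then show ?thesis using e(1) B by (simp add: c_def field_simps)
  qed
  then show ?thesis using e(1) by (intro that[of "2 / e" N]) auto
qed

lemma distributionI:
  fixes u :: "'n::finite distr"
  assumes add: "\<And>\<phi> \<psi>. \<phi> \<in> test_functions \<Longrightarrow> \<psi> \<in> test_functions \<Longrightarrow>
      u (\<lambda>x. \<phi> x + \<psi> x) = u \<phi> + u \<psi>"
    and scale: "\<And>c \<phi>. \<phi> \<in> test_functions \<Longrightarrow> u (\<lambda>x. c * \<phi> x) = c * u \<phi>"
    and bound: "\<And>\<phi> B. \<phi> \<in> test_functions \<Longrightarrow> B > 0 \<Longrightarrow> derivs_bounded N B \<phi> \<Longrightarrow>
      norm (u \<phi>) \<le> C * B"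
  shows "u \<in> distributions"
proof -
  have "continuous_map test_topology euclidean u"
    unfolding continuous_map_def
  proof (intro conjI allI impI)
    fix V :: "complex set" assume "openin euclidean V"
    then have V: "open V" by simp
    show "openin test_topology {\<phi> \<in> topspace test_topology. u \<phi> \<in> V}"
      unfolding openin_test_topology
    proof (intro conjI ballI)
      fix \<phi> assume "\<phi> \<in> {\<phi> \<in> topspace test_topology. u \<phi> \<in> V}"
      then have \<phi>: "\<phi> \<in> test_functions" and "u \<phi> \<in> V" by auto
      with V obtain d where d: "d > 0" "ball (u \<phi>) d \<subseteq> V" by (meson open_contains_ball)
      define e where "e = d / (2 * (\<bar>C\<bar> + 1))"
      have e: "e > 0" using d by (simp add: e_def)
      have "test_nbhd N e \<phi> \<subseteq> {\<phi> \<in> topspace test_topology. u \<phi> \<in> V}"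
      proof
        fix \<psi> assume "\<psi> \<in> test_nbhd N e \<phi>"
        then have \<psi>: "\<psi> \<in> test_functions" and "derivs_bounded N e (\<lambda>x. \<psi> x - \<phi> x)"
          using test_nbhd_iff[OF \<phi>] by (auto simp: derivs_bounded_def less_imp_le)
        then have "norm (u (\<lambda>x. \<psi> x - \<phi> x)) \<le> C * e"
          using \<phi> e by (intro bound test_diff)
        also have "\<dots> \<le> (\<bar>C\<bar> + 1) * e" using e by (intro mult_right_mono) auto
        also have "\<dots> = d / 2"
          by (simp add: e_def divide_simps)
        also have "\<dots> < d" using d by simp
        finally have "norm (u (\<lambda>x. \<psi> x - \<phi> x)) < d" .
        moreover have "u (\<lambda>x. \<psi> x - \<phi> x) = u \<psi> - u \<phi>"
          using add[OF \<psi> test_scale[OF \<phi>, of "-1"]] scale[OF \<phi>, of "-1"] by simp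
        ultimately have "u \<psi> \<in> ball (u \<phi>) d" by (simp add: dist_norm norm_minus_commute)
        with d \<psi> show "\<psi> \<in> {\<phi> \<in> topspace test_topology. u \<phi> \<in> V}" by auto
      qed
      with e show "\<exists>N. \<exists>e>0. test_nbhd N e \<phi> \<subseteq> {\<phi> \<in> topspace test_topology. u \<phi> \<in> V}"
        by blast
    qed auto
  qed auto
  then show ?thesis using add scale by (simp add: distributions_def)
qed

lemma distr_deriv_distribution:
  fixes u :: "'n::finite distr"
  assumes u: "u \<in> distributions"
  shows "distr_deriv i u \<in> distributions"
proof -
  obtain N C where C: "C > 0"
    "\<forall>\<phi>\<in>test_functions. \<forall>B>0. derivs_bounded N B \<phi> \<longrightarrow> norm (u \<phi>) \<le> C * B"
    using distribution_finite_order[OF u] by metis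
  show ?thesis
  proof (rule distributionI[where N = "Suc N" and C = C])
    fix \<phi> :: "real^'n \<Rightarrow> complex" and B :: real
    assume \<phi>: "\<phi> \<in> test_functions" "B > 0" "derivs_bounded (Suc N) B \<phi>"
    then have "derivs_bounded N B (pdiff i \<phi>)"
      using pdiffs_append[of _ "[i]" \<phi>] unfolding derivs_bounded_def
      by (auto dest: spec[of _ "_ @ [i]"])
    with C(2) \<phi> show "norm (distr_deriv i u \<phi>) \<le> C * B"
      by (simp add: distr_deriv_def)
  next
    fix \<phi> \<psi> :: "real^'n \<Rightarrow> complex"
    assume \<phi>: "\<phi> \<in> test_functions" "\<psi> \<in> test_functions"
    have "pdiff i (\<lambda>x. \<phi> x + \<psi> x) = (\<lambda>x. pdiff i \<phi> x + pdiff i \<psi> x)"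
      using pdiffs_lincomb[of \<phi> \<psi> "[i]" 1 1] \<phi> by simp
    then show "distr_deriv i u (\<lambda>x. \<phi> x + \<psi> x) = distr_deriv i u \<phi> + distr_deriv i u \<psi>"
      using \<phi> by (simp add: distr_deriv_def distribution_add[OF u])
  next
    fix c and \<phi> :: "real^'n \<Rightarrow> complex"
    assume \<phi>: "\<phi> \<in> test_functions"
    then show "distr_deriv i u (\<lambda>x. c * \<phi> x) = c * distr_deriv i u \<phi>"
      using pdiffs_scale[of \<phi> "[i]" c] by (simp add: distr_deriv_def distribution_scale[OF u])
  qed
qed

lemma distribution_lincomb:
  fixes u v :: "'n::finite distr"
  assumes u: "u \<in> distributions" and v: "v \<in> distributions"
  shows "(\<lambda>\<phi>. a * u \<phi> + b * v \<phi>) \<in> distributions"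
proof -
  obtain N C where C: "C > 0"
    "\<forall>\<phi>\<in>test_functions. \<forall>B>0. derivs_bounded N B \<phi> \<longrightarrow> norm (u \<phi>) \<le> C * B"
    using distribution_finite_order[OF u] by metis
  obtain M D where D: "D > 0"
    "\<forall>\<phi>\<in>test_functions. \<forall>B>0. derivs_bounded M B \<phi> \<longrightarrow> norm (v \<phi>) \<le> D * B"
    using distribution_finite_order[OF v] by metis
  show ?thesis
  proof (rule distributionI[where N = "max N M" and C = "norm a * C + norm b * D"])
    fix \<phi> :: "real^'n \<Rightarrow> complex" and B :: real
    assume \<phi>: "\<phi> \<in> test_functions" "B > 0" "derivs_bounded (max N M) B \<phi>"
    then have "derivs_bounded N B \<phi>" "derivs_bounded M B \<phi>" by (auto simp: derivs_bounded_def)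
    then have "norm (u \<phi>) \<le> C * B" "norm (v \<phi>) \<le> D * B" using C(2) D(2) \<phi> by auto
    then have "norm (a * u \<phi>) \<le> norm a * (C * B)" "norm (b * v \<phi>) \<le> norm b * (D * B)"
      by (simp_all add: norm_mult mult_left_mono)
    then show "norm (a * u \<phi> + b * v \<phi>) \<le> (norm a * C + norm b * D) * B"
      by (intro norm_triangle_le) (simp add: algebra_simps)
  qed (auto simp: distribution_add[OF u] distribution_add[OF v] distribution_scale[OF u]
      distribution_scale[OF v] algebra_simps)
qed

lemma distributions_sum:
  assumes "\<And>a. a \<in> A \<Longrightarrow> u a \<in> distributions"
  shows "(\<lambda>\<phi>. \<Sum>a\<in>A. u a \<phi>) \<in> distributions"
  using assms
proof (induction A rule: infinite_finite_induct)
  case (insert a A)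
  then show ?case using distribution_lincomb[of "u a" "\<lambda>\<phi>. \<Sum>a\<in>A. u a \<phi>" 1 1] by simp
qed (auto intro: distributionI[where C = 0])

section \<open>Averages along closed lines\<close>

text \<open>
  The weight \<open>1\<close> gives the Radon transform of a test function, an exponential weight projects onto a
  Fourier mode in direction \<open>v\<close>, and a Fejer kernel as weight gives a smoothing operator.
\<close>

definition line_avg ::
    "(real \<Rightarrow> complex) \<Rightarrow> real^'n::finite \<Rightarrow> (real^'n \<Rightarrow> complex) \<Rightarrow> real^'n \<Rightarrow> complex" where
  "line_avg w v \<phi> x = integral {0..1} (\<lambda>t. w t * \<phi> (x + t *\<^sub>R v))"

lemma radon_test_eq_line_avg: "radon_test \<phi> v = line_avg (\<lambda>_. 1) v \<phi>"
  by (simp add: radon_test_def line_avg_def fun_eq_iff)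

lemma line_avg_integrable:
  assumes "continuous_on {0..1} w" "\<phi> \<in> test_functions"
  shows "(\<lambda>t. w t * \<phi> (x + t *\<^sub>R v)) integrable_on {0..1}"
  by (intro integrable_continuous_interval continuous_intros assms(1)
      continuous_on_compose2[OF test_continuous[OF assms(2), of UNIV]]) auto

text \<open>
  Differentiation under the integral sign. The integrand is differentiated as a function on \<open>\<real>\<^sup>n\<close> and
  not only along coordinate axes, since test functions have total derivatives.
\<close>

lemma line_avg_has_derivative:
  fixes \<phi> :: "real^'n::finite \<Rightarrow> complex"
  assumes w: "continuous_on {0..1} w" and \<phi>: "\<phi> \<in> test_functions"
  shows "(line_avg w v \<phi> has_derivative
           (\<lambda>h. \<Sum>i\<in>UNIV. of_real (h $ i) * line_avg w v (pdiff i \<phi>) x)) (at x)"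
proof -
  define D where "D x t h = w t * (\<Sum>i\<in>UNIV. of_real (h $ i) * pdiff i \<phi> (x + t *\<^sub>R v))"
    for x t and h :: "real^'n"
  define F where "F x t = Blinfun (D x t)" for x t
  have "bounded_linear (D x t)" for x t
    unfolding D_def linear_conv_bounded_linear[symmetric]
    by (auto simp: linear_iff sum.distrib algebra_simps sum_distrib_left scaleR_conv_of_real[of _ "_ :: complex"])
  then have F: "blinfun_apply (F x t) = D x t" for x t
    by (simp add: F_def bounded_linear_Blinfun_apply)
  have cont: "continuous_on (UNIV \<times> cbox 0 1) (\<lambda>(x, t). F x t)"
  proof (rule continuous_on_blinfun_componentwise)
    fix h :: "real^'n"
    have "continuous_on (UNIV \<times> cbox (0::real) 1) (\<lambda>z. D (fst z) (snd z) h)"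
      unfolding D_def
      by (intro continuous_intros continuous_on_compose2[OF w]
          continuous_on_compose2[OF test_continuous[OF pdiff_test[OF \<phi>], of UNIV]]) auto
    then show "continuous_on (UNIV \<times> cbox 0 1) (\<lambda>z. blinfun_apply (case z of (x, t) \<Rightarrow> F x t) h)"
      by (simp add: F case_prod_unfold)
  qed
  have "((\<lambda>x. integral (cbox 0 1) (\<lambda>t. w t * \<phi> (x + t *\<^sub>R v))) has_derivative
      blinfun_apply (integral (cbox 0 1) (F x))) (at x within UNIV)"
  proof (rule leibniz_rule[OF _ _ cont])
    fix y :: "real^'n" and t :: real
    have "((\<lambda>y. \<phi> (y + t *\<^sub>R v)) has_derivative
        (\<lambda>h. \<Sum>i\<in>UNIV. of_real (h $ i) * pdiff i \<phi> (y + t *\<^sub>R v))) (at y)"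
      by (rule has_derivative_compose[OF _ has_derivative_pdiff[OF test_differentiable[OF \<phi>]]])
        (auto intro!: derivative_eq_intros)
    then show "((\<lambda>y. w t * \<phi> (y + t *\<^sub>R v)) has_derivative blinfun_apply (F y t)) (at y within UNIV)"
      unfolding F D_def by (intro has_derivative_mult_right) simp
  qed (use line_avg_integrable[OF w \<phi>] in auto)
  moreover have "blinfun_apply (integral (cbox 0 1) (F x)) =
      (\<lambda>h. \<Sum>i\<in>UNIV. of_real (h $ i) * line_avg w v (pdiff i \<phi>) x)"
  proof
    fix h
    have "continuous_on (cbox 0 1) (\<lambda>t. case (x, t) of (x, t) \<Rightarrow> F x t)"
      by (rule continuous_on_compose2[OF cont]) (auto intro!: continuous_intros)
    then have "F x integrable_on cbox 0 1" by (intro integrable_continuous) simp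
    then have "blinfun_apply (integral (cbox 0 1) (F x)) h = integral {0..1} (\<lambda>t. D x t h)"
      by (simp add: blinfun_apply_integral F)
    also have "\<dots> = integral {0..1}
        (\<lambda>t. \<Sum>i\<in>UNIV. of_real (h $ i) * (w t * pdiff i \<phi> (x + t *\<^sub>R v)))"
      by (simp add: D_def sum_distrib_left mult.left_commute)
    also have "\<dots> = (\<Sum>i\<in>UNIV. of_real (h $ i) * line_avg w v (pdiff i \<phi>) x)"
      unfolding line_avg_def using line_avg_integrable[OF w pdiff_test[OF \<phi>]]
      by (subst integral_sum) (auto intro: integrable_on_mult_right)
    finally show "blinfun_apply (integral (cbox 0 1) (F x)) h =
      (\<Sum>i\<in>UNIV. of_real (h $ i) * line_avg w v (pdiff i \<phi>) x)" .
  qed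
  ultimately show ?thesis
    by (simp add: line_avg_def[abs_def])
qed

lemma pdiff_line_avg:
  assumes "continuous_on {0..1} w" "\<phi> \<in> test_functions"
  shows "pdiff i (line_avg w v \<phi>) = line_avg w v (pdiff i \<phi>)"
proof
  fix x
  show "pdiff i (line_avg w v \<phi>) x = line_avg w v (pdiff i \<phi>) x"
    using pdiff_eqI[OF line_avg_has_derivative[OF assms]]
    by (simp add: axis_def if_distrib if_distribR cong: if_cong)
qed

lemma pdiffs_line_avg:
  assumes "continuous_on {0..1} w" "\<phi> \<in> test_functions"
  shows "pdiffs \<alpha> (line_avg w v \<phi>) = line_avg w v (pdiffs \<alpha> \<phi>)"
  by (induction \<alpha>) (simp_all add: pdiff_line_avg assms)

lemma line_avg_test:
  assumes "continuous_on {0..1} w" "\<phi> \<in> test_functions"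
  shows "line_avg w v \<phi> \<in> test_functions"
proof (rule test_functionI)
  fix x k :: "real^'a" assume "k \<in> int_lattice"
  then have "\<phi> (x + k + t *\<^sub>R v) = \<phi> (x + t *\<^sub>R v)" for t
    using test_periodic[OF assms(2), of k "x + t *\<^sub>R v"] by (simp add: algebra_simps)
  then show "line_avg w v \<phi> (x + k) = line_avg w v \<phi> x"
    by (simp add: line_avg_def)
next
  fix \<alpha> x
  show "pdiffs \<alpha> (line_avg w v \<phi>) differentiable (at x)"
    unfolding pdiffs_line_avg[OF assms] differentiable_def
    using line_avg_has_derivative[OF assms(1) pdiffs_test[OF assms(2)]] by blast
qed

lemma line_avg_lincomb:
  assumes "continuous_on {0..1} w" "\<phi> \<in> test_functions" "\<psi> \<in> test_functions"
  shows "line_avg w v (\<lambda>x. a * \<phi> x + b * \<psi> x) = (\<lambda>x. a * line_avg w v \<phi> x + b * line_avg w v \<psi> x)"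
proof
  fix x
  have "integral {0..1} (\<lambda>t. a * (w t * \<phi> (x + t *\<^sub>R v)) + b * (w t * \<psi> (x + t *\<^sub>R v))) =
      a * line_avg w v \<phi> x + b * line_avg w v \<psi> x"
    unfolding line_avg_def
    by (intro integral_unique has_integral_add has_integral_mult_right integrable_integral
        line_avg_integrable assms)
  then show "line_avg w v (\<lambda>x. a * \<phi> x + b * \<psi> x) x = a * line_avg w v \<phi> x + b * line_avg w v \<psi> x"
    by (simp add: line_avg_def algebra_simps)
qed

lemma norm_line_avg_le:
  assumes "continuous_on {0..1} w" "\<phi> \<in> test_functions"
    and w: "\<And>t. norm (w t) \<le> 1" and B: "\<And>x. norm (\<phi> x) \<le> B"
  shows "norm (line_avg w v \<phi> x) \<le> B"
proof -
  have "norm (w t * \<phi> (x + t *\<^sub>R v)) \<le> B" for t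
    using mult_mono[OF w B] by (simp add: norm_mult)
  then have "norm (integral {0..1} (\<lambda>t. w t * \<phi> (x + t *\<^sub>R v))) \<le> B * (1 - 0)"
    by (intro integral_bound line_avg_integrable[OF assms(1,2)] order.refl
        continuous_intros assms(1) continuous_on_compose2[OF test_continuous[OF assms(2), of UNIV]]) auto
  then show ?thesis by (simp add: line_avg_def)
qed

section \<open>Exponentials\<close>

text \<open>
  The eigenvalue of the derivative for oscillations with frequency \<open>r\<close>.
\<close>

abbreviation freq :: "real \<Rightarrow> complex" where
  "freq r \<equiv> 2 * of_real pi * \<i> * of_real r"

definition wave :: "real \<Rightarrow> real \<Rightarrow> complex" where
  "wave r t = cis (2 * pi * r * t)"

lemma norm_wave [simp]: "norm (wave r t) = 1"
  by (simp add: wave_def)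

lemma wave_0 [simp]: "wave 0 t = 1" "wave r 0 = 1"
  by (simp_all add: wave_def)

lemma wave_1: "r \<in> \<int> \<Longrightarrow> wave r 1 = 1"
  using cis_multiple_2pi[of r] by (simp add: wave_def)

lemma wave_mult: "wave r t * wave s t = wave (r + s) t"
  by (simp add: wave_def cis_mult algebra_simps)

lemma continuous_on_wave [continuous_intros]: "continuous_on S (wave r)"
  unfolding wave_def[abs_def] by (intro continuous_intros)

lemma wave_has_vector_derivative:
  "(wave r has_vector_derivative freq r * wave r t) (at t within S)"
proof -
  have "((\<lambda>z. exp (freq r * z)) has_field_derivative freq r * exp (freq r * of_real t)) (at (of_real t))"
    by (auto intro!: derivative_eq_intros)
  from has_vector_derivative_real_field[OF this] show ?thesis
    by (simp add: wave_def[abs_def] cis_conv_exp mult_ac)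
qed

lemma integral_wave:
  assumes "r \<in> \<int>"
  shows "(wave r has_integral (if r = 0 then 1 else 0)) {0..1}"
proof (cases "r = 0")
  case True
  then have "wave r = (\<lambda>_. 1)" by (auto simp: fun_eq_iff)
  then show ?thesis using True has_integral_const_real[of "1::complex" 0 1] by simp
next
  case False
  have "((\<lambda>t. freq r * wave r t) has_integral (wave r 1 - wave r 0)) {0..1}"
    by (intro fundamental_theorem_of_calculus wave_has_vector_derivative) simp
  then have "((\<lambda>t. freq r * wave r t) has_integral 0) {0..1}"
    using assms by (simp add: wave_1)
  from has_integral_mult_right[OF this, of "inverse (freq r)"] show ?thesis
    using False by (simp add: field_simps)
qed

text \<open>
  The line through \<open>x\<close> in an integer direction closes up on the torus, so the derivative of
  \<open>t \<mapsto> wave (-r) t * \<phi> (x + t *\<^sub>R v)\<close> has integral zero over a period. The product rule turns this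
  into an eigenvalue equation: averaging against \<open>wave (-r)\<close> projects onto the functions that
  oscillate with frequency \<open>r\<close> in direction \<open>v\<close>. The case \<open>r = 0\<close> says that \<open>radon_test \<phi> v\<close> is constant
  along \<open>v\<close>.
\<close>

lemma line_avg_wave_deriv:
  fixes \<phi> :: "real^'n::finite \<Rightarrow> complex"
  assumes \<phi>: "\<phi> \<in> test_functions" and v: "v \<in> int_lattice" and r: "r \<in> \<int>"
  shows "(\<Sum>i\<in>UNIV. of_real (v $ i) * pdiff i (line_avg (wave (- r)) v \<phi>) x) =
    freq r * line_avg (wave (- r)) v \<phi> x"
proof -
  let ?w = "wave (- r)"
  let ?g = "\<lambda>t. \<Sum>i\<in>UNIV. of_real (v $ i) * pdiff i \<phi> (x + t *\<^sub>R v)"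
  have "((\<lambda>t. ?w t * \<phi> (x + t *\<^sub>R v)) has_vector_derivative
      ?w t * ?g t + freq (- r) * ?w t * \<phi> (x + t *\<^sub>R v)) (at t within {0..1})" for t
    by (intro has_vector_derivative_mult wave_has_vector_derivative
        has_vector_derivative_along_line test_differentiable[OF \<phi>])
  then have "((\<lambda>t. ?w t * ?g t + freq (- r) * ?w t * \<phi> (x + t *\<^sub>R v)) has_integral
      ?w 1 * \<phi> (x + 1 *\<^sub>R v) - ?w 0 * \<phi> (x + 0 *\<^sub>R v)) {0..1}"
    by (intro fundamental_theorem_of_calculus) auto
  moreover have "?w 1 = 1" using r by (intro wave_1) simp
  ultimately have 0: "((\<lambda>t. ?w t * ?g t + freq (- r) * ?w t * \<phi> (x + t *\<^sub>R v)) has_integral 0) {0..1}"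
    using test_periodic[OF \<phi> v] by simp
  have I: "((\<lambda>t. ?w t * \<psi> (x + t *\<^sub>R v)) has_integral line_avg ?w v \<psi> x) {0..1}"
    if "\<psi> \<in> test_functions" for \<psi>
    unfolding line_avg_def
    by (intro integrable_integral line_avg_integrable that continuous_intros)
  have "((\<lambda>t. (\<Sum>i\<in>UNIV. of_real (v $ i) * (?w t * pdiff i \<phi> (x + t *\<^sub>R v))) +
        freq (- r) * (?w t * \<phi> (x + t *\<^sub>R v))) has_integral
      (\<Sum>i\<in>UNIV. of_real (v $ i) * line_avg ?w v (pdiff i \<phi>) x) + freq (- r) * line_avg ?w v \<phi> x) {0..1}"
    by (intro has_integral_add has_integral_sum has_integral_mult_right I pdiff_test \<phi>) auto
  also have "(\<lambda>t. (\<Sum>i\<in>UNIV. of_real (v $ i) * (?w t * pdiff i \<phi> (x + t *\<^sub>R v))) +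
        freq (- r) * (?w t * \<phi> (x + t *\<^sub>R v))) =
      (\<lambda>t. ?w t * ?g t + freq (- r) * ?w t * \<phi> (x + t *\<^sub>R v))"
    by (auto simp: fun_eq_iff sum_distrib_left mult_ac)
  finally have "(\<Sum>i\<in>UNIV. of_real (v $ i) * line_avg ?w v (pdiff i \<phi>) x) +
      freq (- r) * line_avg ?w v \<phi> x = 0"
    using 0 has_integral_unique by blast
  then show ?thesis
    by (simp add: pdiff_line_avg[OF continuous_on_wave \<phi>])
qed

lemma torus_exp_eq_cis: "torus_exp k x = cis (2 * pi * (k \<bullet> x))"
  by (simp add: torus_exp_def cis_conv_exp mult_ac)

lemma torus_exp_line: "torus_exp k (x + t *\<^sub>R v) = torus_exp k x * wave (k \<bullet> v) t"
  by (simp add: torus_exp_eq_cis wave_def cis_mult algebra_simps)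

lemma torus_exp_0 [simp]: "torus_exp k 0 = 1"
  by (simp add: torus_exp_eq_cis)

lemma norm_torus_exp [simp]: "norm (torus_exp k x) = 1"
  by (simp add: torus_exp_eq_cis)

lemma int_lattice_inner: "k \<in> int_lattice \<Longrightarrow> l \<in> int_lattice \<Longrightarrow> k \<bullet> l \<in> \<int>"
  by (auto simp: int_lattice_def inner_vec_def intro!: Ints_sum Ints_mult)

lemma axis_int_lattice [simp]: "axis i 1 \<in> int_lattice"
  by (auto simp: int_lattice_def axis_def)

lemma uminus_int_lattice [simp]: "- k \<in> int_lattice \<longleftrightarrow> k \<in> int_lattice"
  by (simp add: int_lattice_def)

lemma inner_axis_1 [simp]: "(k :: real^'n) \<bullet> axis i 1 = k $ i"
  by (simp add: inner_axis)

lemma torus_exp_has_derivative: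
  "(torus_exp k has_derivative (\<lambda>h. freq (k \<bullet> h) * torus_exp k x)) (at x)"
proof -
  have "((\<lambda>x. freq (k \<bullet> x)) has_derivative (\<lambda>h. freq (k \<bullet> h))) (at x)"
    by (intro has_derivative_mult_right has_derivative_of_real has_derivative_inner_right
        has_derivative_ident)
  from has_derivative_compose[OF this DERIV_exp[unfolded has_field_derivative_def]]
  show ?thesis by (simp add: torus_exp_def[abs_def] mult_ac)
qed

lemma pdiff_torus_exp: "pdiff i (torus_exp k) = (\<lambda>x. freq (k $ i) * torus_exp k x)"
  by (rule ext, subst pdiff_eqI[OF torus_exp_has_derivative]) simp

lemma pdiffs_torus_exp:
  "pdiffs \<alpha> (torus_exp k) = (\<lambda>x. (\<Prod>i\<leftarrow>\<alpha>. freq (k $ i)) * torus_exp k x)"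
proof (induction \<alpha>)
  case (Cons i \<alpha>)
  let ?c = "\<Prod>i\<leftarrow>\<alpha>. freq (k $ i)"
  have "pdiff i (\<lambda>x. ?c * torus_exp k x) x = freq (k $ i) * (?c * torus_exp k x)" for x
    by (subst pdiff_eqI[OF has_derivative_mult_right[OF torus_exp_has_derivative]]) simp
  then show ?case unfolding pdiffs_Cons Cons.IH by (simp add: fun_eq_iff mult.assoc)
qed simp

lemma torus_exp_test [simp]:
  assumes "k \<in> int_lattice"
  shows "torus_exp k \<in> test_functions"
proof (rule test_functionI)
  fix x l :: "real^'a" assume "l \<in> int_lattice"
  then have "wave (k \<bullet> l) 1 = 1" using assms by (intro wave_1 int_lattice_inner)
  then show "torus_exp k (x + l) = torus_exp k x"
    using torus_exp_line[of k x 1 l] by simp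
next
  fix \<alpha> x
  show "pdiffs \<alpha> (torus_exp k) differentiable (at x)"
    unfolding pdiffs_torus_exp differentiable_def
    using has_derivative_mult_right[OF torus_exp_has_derivative] by blast
qed

lemma line_avg_torus_exp:
  assumes "k \<in> int_lattice" "v \<in> int_lattice" "r \<in> \<int>"
  shows "line_avg (wave (- r)) v (torus_exp k) x = (if k \<bullet> v = r then torus_exp k x else 0)"
proof -
  have "k \<bullet> v - r \<in> \<int>" using assms by (intro Ints_diff int_lattice_inner)
  from integral_unique[OF has_integral_mult_right[OF integral_wave[OF this], of "torus_exp k x"]]
  show ?thesis
    by (auto simp: line_avg_def torus_exp_line wave_mult mult.left_commute[of "wave _ _" "torus_exp _ _"])
qed

lemma radon_test_torus_exp:
  assumes "k \<in> int_lattice" "v \<in> int_lattice"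
  shows "radon_test (torus_exp k) v = (\<lambda>x. if k \<bullet> v = 0 then torus_exp k x else 0)"
  using line_avg_torus_exp[OF assms, of 0]
  by (simp add: radon_test_eq_line_avg fun_eq_iff wave_def line_avg_def)

section \<open>Fourier coefficients of test functions\<close>

definition indices :: "'n::finite list" where
  "indices = (SOME is. set is = UNIV)"

lemma set_indices [simp]: "set (indices :: 'n::finite list) = UNIV"
  unfolding indices_def by (rule someI_ex) (simp add: finite_list)

text \<open>
  Averaging in the coordinate directions \<open>i\<close>, one after the other, against the exponentials with
  frequencies \<open>k $ i\<close> keeps only the Fourier modes whose frequencies at these coordinates agree with
  those of \<open>k\<close>. For all coordinates this leaves the mode of \<open>k\<close>; its coefficient is the value at \<open>0\<close>.
  This replaces an integral over the unit cube by one-dimensional integrals.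
\<close>

definition isolate :: "'n::finite list \<Rightarrow> real^'n \<Rightarrow> (real^'n \<Rightarrow> complex) \<Rightarrow> real^'n \<Rightarrow> complex" where
  "isolate is k \<phi> = foldr (\<lambda>i. line_avg (wave (- (k $ i))) (axis i 1)) is \<phi>"

definition test_coeff :: "(real^'n::finite \<Rightarrow> complex) \<Rightarrow> real^'n \<Rightarrow> complex" where
  "test_coeff \<phi> k = isolate indices k \<phi> 0"

lemma isolate_Nil [simp]: "isolate [] k \<phi> = \<phi>"
  and isolate_Cons [simp]:
    "isolate (i # is) k \<phi> = line_avg (wave (- (k $ i))) (axis i 1) (isolate is k \<phi>)"
  by (simp_all add: isolate_def)

lemma isolate_test [simp]: "\<phi> \<in> test_functions \<Longrightarrow> isolate is k \<phi> \<in> test_functions"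
  by (induction "is") (auto intro!: line_avg_test continuous_intros)

lemma pdiff_isolate:
  "\<phi> \<in> test_functions \<Longrightarrow> pdiff i (isolate is k \<phi>) = isolate is k (pdiff i \<phi>)"
  by (induction "is") (simp_all add: pdiff_line_avg continuous_on_wave)

lemma isolate_lincomb:
  assumes "\<phi> \<in> test_functions" "\<psi> \<in> test_functions"
  shows "isolate is k (\<lambda>x. a * \<phi> x + b * \<psi> x) = (\<lambda>x. a * isolate is k \<phi> x + b * isolate is k \<psi> x)"
  using assms by (induction "is") (simp_all add: line_avg_lincomb continuous_on_wave)

lemma norm_isolate_le:
  assumes "\<phi> \<in> test_functions" and "\<And>x. norm (\<phi> x) \<le> B"
  shows "norm (isolate is k \<phi> x) \<le> B"
  using assms
  by (induction "is" arbitrary: x) (auto intro!: norm_line_avg_le continuous_intros)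

text \<open>
  The average in direction \<open>i\<close> produces the eigenvalue equation, and the averages applied after it
  preserve the equation because they commute with the derivative.
\<close>

lemma isolate_eigenfunction:
  assumes \<phi>: "\<phi> \<in> test_functions" and k: "k \<in> int_lattice" and i: "i \<in> set is"
  shows "pdiff i (isolate is k \<phi>) = (\<lambda>x. freq (k $ i) * isolate is k \<phi> x)"
  using i
proof (induction "is")
  case (Cons j "is")
  let ?\<psi> = "isolate is k \<phi>"
  show ?case
  proof (cases "j = i")
    case True
    have "k $ i \<in> \<int>" using k by (simp add: int_lattice_def)
    from line_avg_wave_deriv[OF isolate_test[OF \<phi>] axis_int_lattice this] True show ?thesis
      by (simp add: axis_def if_distrib if_distribR fun_eq_iff cong: if_cong)
  next
    case False
    with Cons have IH: "pdiff i ?\<psi> = (\<lambda>x. freq (k $ i) * ?\<psi> x)" by simp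
    have "pdiff i (isolate (j # is) k \<phi>) = line_avg (wave (- (k $ j))) (axis j 1) (pdiff i ?\<psi>)"
      using \<phi> by (simp add: pdiff_line_avg continuous_on_wave)
    also have "\<dots> = (\<lambda>x. freq (k $ i) * line_avg (wave (- (k $ j))) (axis j 1) ?\<psi> x)"
      unfolding IH
      using line_avg_lincomb[OF continuous_on_wave isolate_test[OF \<phi>] isolate_test[OF \<phi>],
          where a = "freq (k $ i)" and b = 0] by simp
    finally show ?thesis by simp
  qed
qed simp

lemma isolate_torus_exp:
  assumes "k \<in> int_lattice" "l \<in> int_lattice"
  shows "isolate is k (torus_exp l) = (\<lambda>x. if \<forall>i\<in>set is. l $ i = k $ i then torus_exp l x else 0)"
proof (induction "is")
  case (Cons i "is")
  have "k $ i \<in> \<int>" using assms by (simp add: int_lattice_def)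
  from line_avg_torus_exp[OF assms(2) axis_int_lattice this]
  have *: "line_avg (wave (- (k $ i))) (axis i 1) (torus_exp l) =
      (\<lambda>x. if l $ i = k $ i then torus_exp l x else 0)" by (simp add: fun_eq_iff)
  show ?case
  proof (cases "\<forall>i\<in>set is. l $ i = k $ i")
    case True
    with Cons * show ?thesis by simp
  next
    case False
    have "isolate is k (torus_exp l) = (\<lambda>x. 0)"
      by (simp only: Cons.IH if_not_P[OF False])
    moreover have "\<not> (\<forall>j\<in>set (i # is). l $ j = k $ j)" using False by simp
    ultimately show ?thesis
      unfolding if_not_P[OF \<open>\<not> (\<forall>j\<in>set (i # is). l $ j = k $ j)\<close>] by (simp add: line_avg_def fun_eq_iff)
  qed
qed simp

lemma test_coeff_lincomb:
  "\<phi> \<in> test_functions \<Longrightarrow> \<psi> \<in> test_functions \<Longrightarrow>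
    test_coeff (\<lambda>x. a * \<phi> x + b * \<psi> x) k = a * test_coeff \<phi> k + b * test_coeff \<psi> k"
  by (simp add: test_coeff_def isolate_lincomb)

lemma norm_test_coeff_le:
  "\<phi> \<in> test_functions \<Longrightarrow> (\<And>x. norm (\<phi> x) \<le> B) \<Longrightarrow> norm (test_coeff \<phi> k) \<le> B"
  unfolding test_coeff_def by (rule norm_isolate_le)

lemma test_coeff_torus_exp:
  "k \<in> int_lattice \<Longrightarrow> l \<in> int_lattice \<Longrightarrow> test_coeff (torus_exp l) k = (if l = k then 1 else 0)"
  by (simp add: test_coeff_def isolate_torus_exp vec_eq_iff)

lemma test_coeff_pdiff:
  "\<phi> \<in> test_functions \<Longrightarrow> k \<in> int_lattice \<Longrightarrow>
    test_coeff (pdiff i \<phi>) k = freq (k $ i) * test_coeff \<phi> k"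
  unfolding test_coeff_def by (simp add: pdiff_isolate[symmetric] isolate_eigenfunction)

lemma test_coeff_pdiffs_replicate:
  assumes "\<phi> \<in> test_functions" "k \<in> int_lattice"
  shows "test_coeff (pdiffs (replicate m i) \<phi>) k = freq (k $ i) ^ m * test_coeff \<phi> k"
  using assms by (induction m) (simp_all add: test_coeff_pdiff mult.assoc)

text \<open>
  The coefficient of the derivative of order \<open>2 * q\<close> in direction \<open>i\<close> is the given coefficient times
  \<open>(2\<pi>i k\<^sub>i)\<close> to the power \<open>2 * q\<close>. For \<open>k \<noteq> 0\<close> and the direction of the
  largest component of \<open>k\<close> this factor dominates \<open>(1 + \<bar>k\<bar>\<^sup>2)\<close> to the power \<open>q\<close>, up to a constant.
\<close>

lemma test_coeff_decay:
  fixes \<phi> :: "real^'n::finite \<Rightarrow> complex"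
  assumes \<phi>: "\<phi> \<in> test_functions" and k: "k \<in> int_lattice"
    and B: "derivs_bounded (2 * q) (B :: real) \<phi>"
  shows "(1 + (norm k)\<^sup>2) ^ q * norm (test_coeff \<phi> k) \<le> (1 + real CARD('n)) ^ q * B"
proof -
  define r where "r = Max (range (\<lambda>i. \<bar>k $ i\<bar>))"
  have "r \<in> range (\<lambda>i. \<bar>k $ i\<bar>)" unfolding r_def by (intro Max_in) auto
  then obtain i where i: "r = \<bar>k $ i\<bar>" by auto
  have r: "\<bar>k $ j\<bar> \<le> r" for j unfolding r_def by (intro Max_ge) auto
  have le: "1 + (norm k)\<^sup>2 \<le> 1 + real CARD('n) * r\<^sup>2"
  proof -
    have "(norm k)\<^sup>2 = (\<Sum>j\<in>UNIV. (k $ j)\<^sup>2)"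
      by (simp add: norm_vec_def L2_set_def sum_nonneg)
    also have "\<dots> \<le> (\<Sum>j\<in>(UNIV :: 'n set). r\<^sup>2)"
      using power_mono[OF r, of _ 2] by (intro sum_mono) simp
    finally show ?thesis by simp
  qed
  have B0: "norm (pdiffs \<alpha> \<phi> x) \<le> B" if "length \<alpha> \<le> 2 * q" for \<alpha> x
    using B that by (simp add: derivs_bounded_def)
  have Bpos: "B \<ge> 0" using B0[of "[]" 0] norm_ge_zero by (metis le0 list.size(3) order_trans)
  show ?thesis
  proof (cases "r = 0")
    case True
    have "norm (test_coeff \<phi> k) \<le> 1 * B"
      using norm_test_coeff_le[OF \<phi>, of B] B0[of "[]"] by simp
    also have "\<dots> \<le> (1 + real CARD('n)) ^ q * B" by (intro mult_right_mono Bpos) simp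
    moreover have "(1 + (norm k)\<^sup>2) ^ q = 1"
      using le True by (metis add_cancel_right_right add_le_same_cancel1 mult_zero_right
          order_antisym power_one zero_eq_power2 zero_le_power2)
    ultimately show ?thesis by simp
  next
    case False
    have "k $ i \<in> \<int>" using k by (simp add: int_lattice_def)
    then have "1 \<le> r" using False i Ints_nonzero_abs_ge1 by auto
    then have "1 \<le> r\<^sup>2" by (simp add: one_le_power)
    then have "1 + (norm k)\<^sup>2 \<le> (1 + real CARD('n)) * r\<^sup>2"
      using le by (simp add: algebra_simps)
    also have "\<dots> \<le> (1 + real CARD('n)) * (2 * pi * r)\<^sup>2"
    proof (intro mult_left_mono power_mono)
      have "1 * r \<le> (2 * pi) * r"
        using \<open>1 \<le> r\<close> pi_ge_two by (intro mult_right_mono) auto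
      then show "r \<le> 2 * pi * r" by simp
    qed (use \<open>1 \<le> r\<close> in auto)
    finally have "(1 + (norm k)\<^sup>2) ^ q \<le> ((1 + real CARD('n)) * (2 * pi * r)\<^sup>2) ^ q"
      by (intro power_mono) auto
    also have "\<dots> = (1 + real CARD('n)) ^ q * (2 * pi * r) ^ (2 * q)"
      by (simp add: power_mult_distrib power_mult)
    finally have "(1 + (norm k)\<^sup>2) ^ q * norm (test_coeff \<phi> k) \<le>
        (1 + real CARD('n)) ^ q * (2 * pi * r) ^ (2 * q) * norm (test_coeff \<phi> k)"
      by (rule mult_right_mono) simp
    also have "\<dots> = (1 + real CARD('n)) ^ q * norm (test_coeff (pdiffs (replicate (2 * q) i) \<phi>) k)"
      using i by (simp only: test_coeff_pdiffs_replicate[OF \<phi> k])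
        (simp add: norm_mult norm_power)
    also have "\<dots> \<le> (1 + real CARD('n)) ^ q * B"
      by (intro mult_left_mono norm_test_coeff_le B0 pdiffs_test \<phi>) auto
    finally show ?thesis .
  qed
qed

lemma sum_inverse_square_Ints_le:
  fixes T :: "real set"
  assumes "finite T" "T \<subseteq> \<int>"
  shows "(\<Sum>j\<in>T. inverse (1 + j\<^sup>2)) \<le> 5"
proof -
  \<comment> \<open>The subtracted term makes the induction work: it decreases by at least
    the two new summands at each step.\<close>
  have bound: "(\<Sum>j\<in>{- int M..int M}. inverse (1 + (real_of_int j)\<^sup>2)) \<le> 5 - 4 / (real M + 1)" for M
  proof (induction M)
    case (Suc M)
    have eq: "{- int (Suc M)..int (Suc M)} = insert (int M + 1) (insert (- int M - 1) {- int M..int M})"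
      by auto
    have "4 / (2 * (1 + (real M + 1)\<^sup>2)) \<le> 4 / ((real M + 1) * (real M + 2))"
    proof (rule divide_left_mono)
      show "(real M + 1) * (real M + 2) \<le> 2 * (1 + (real M + 1)\<^sup>2)"
        by (simp add: power2_eq_square algebra_simps)
      show "0 < 2 * (1 + (real M + 1)\<^sup>2) * ((real M + 1) * (real M + 2))"
        by (simp add: add_pos_nonneg)
    qed simp
    moreover have "4 / (2 * x) = 2 * inverse x" for x :: real
      by (cases "x = 0") (simp_all add: field_simps)
    moreover have "4 / ((real M + 1) * (real M + 2)) = 4 / (real M + 1) - 4 / (real M + 2)"
      by (simp add: field_simps)
    ultimately have "2 * inverse (1 + (real M + 1)\<^sup>2) \<le> 4 / (real M + 1) - 4 / (real M + 2)"
      by metis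
    moreover have "(\<Sum>j\<in>{- int (Suc M)..int (Suc M)}. inverse (1 + (real_of_int j)\<^sup>2)) =
      2 * inverse (1 + (real M + 1)\<^sup>2) + (\<Sum>j\<in>{- int M..int M}. inverse (1 + (real_of_int j)\<^sup>2))"
      unfolding eq by (simp add: power2_eq_square algebra_simps)
    ultimately show ?case using Suc by (simp add: algebra_simps)
  qed simp
  obtain S :: "int set" where S: "T = of_int ` S" "inj_on real_of_int S"
    using assms(2) unfolding Ints_def by (auto simp: subset_image_iff inj_on_def)
  then have "finite S" using assms(1) by (metis finite_imageD)
  define M where "M = nat (Max (insert 0 (abs ` S)))"
  have "S \<subseteq> {- int M..int M}"
  proof
    fix j assume "j \<in> S"
    then have "\<bar>j\<bar> \<le> Max (insert 0 (abs ` S))" using \<open>finite S\<close> by (intro Max_ge) auto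
    then show "j \<in> {- int M..int M}" by (auto simp: M_def)
  qed
  then have "(\<Sum>j\<in>S. inverse (1 + (real_of_int j)\<^sup>2)) \<le>
      (\<Sum>j\<in>{- int M..int M}. inverse (1 + (real_of_int j)\<^sup>2))"
    by (intro sum_mono2) auto
  also have "\<dots> \<le> 5" using bound[of M] by (smt (verit) divide_nonneg_nonneg of_nat_0_le_iff)
  finally show ?thesis using S by (simp add: sum.reindex)
qed

text \<open>
  The summand is dominated by the product over the coordinates of \<open>1 / (1 + k\<^sub>i\<^sup>2)\<close>, and finite sums of
  this product are bounded by a product of one-dimensional sums.
\<close>

lemma summable_int_lattice:
  "(\<lambda>k :: real^'n::finite. inverse ((1 + (norm k)\<^sup>2) ^ CARD('n))) summable_on int_lattice"
proof (rule nonneg_bdd_above_summable_on)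
  show "bdd_above (sum (\<lambda>k :: real^'n. inverse ((1 + (norm k)\<^sup>2) ^ CARD('n))) `
      {F. F \<subseteq> int_lattice \<and> finite F})"
  proof (rule bdd_aboveI2)
    fix F :: "(real^'n) set" assume "F \<in> {F. F \<subseteq> int_lattice \<and> finite F}"
    then have F: "F \<subseteq> int_lattice" "finite F" by auto
    define T where "T = (\<Union>i. (\<lambda>k. k $ i) ` F)"
    have T: "finite T" "T \<subseteq> \<int>" using F by (auto simp: T_def int_lattice_def)
    have "(\<Sum>k\<in>F. inverse ((1 + (norm k)\<^sup>2) ^ CARD('n))) \<le>
        (\<Sum>k\<in>F. \<Prod>i\<in>UNIV. inverse (1 + (k $ i)\<^sup>2))"
    proof (intro sum_mono)
      fix k :: "real^'n"
      have "(\<Prod>i\<in>(UNIV :: 'n set). 1 + (k $ i)\<^sup>2) \<le> (\<Prod>i\<in>(UNIV :: 'n set). 1 + (norm k)\<^sup>2)"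
        using component_le_norm_cart[of k]
        by (intro prod_mono conjI add_left_mono) (auto intro: power2_le_iff_abs_le[THEN iffD2])
      moreover have "(\<Prod>i\<in>(UNIV :: 'n set). 1 + (k $ i)\<^sup>2) > 0"
        by (intro prod_pos) (auto intro: add_pos_nonneg)
      ultimately show "inverse ((1 + (norm k)\<^sup>2) ^ CARD('n)) \<le> (\<Prod>i\<in>UNIV. inverse (1 + (k $ i)\<^sup>2))"
        using prod_inversef[of "\<lambda>i. 1 + (k $ i)\<^sup>2" UNIV] by (simp add: o_def le_imp_inverse_le)
    qed
    also have "\<dots> = (\<Sum>p\<in>($) ` F. \<Prod>i\<in>UNIV. inverse (1 + (p i)\<^sup>2))"
      by (subst sum.reindex) (auto simp: inj_on_def vec_eq_iff)
    also have "\<dots> \<le> (\<Sum>p\<in>PiE (UNIV :: 'n set) (\<lambda>_. T). \<Prod>i\<in>UNIV. inverse (1 + (p i)\<^sup>2))"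
    proof (rule sum_mono2)
      show "finite (PiE (UNIV :: 'n set) (\<lambda>_. T))" using T(1) by (simp add: finite_PiE)
      show "($) ` F \<subseteq> PiE UNIV (\<lambda>_. T)" by (auto simp: T_def)
      show "0 \<le> (\<Prod>i\<in>UNIV. inverse (1 + (p i)\<^sup>2))" for p :: "'n \<Rightarrow> real"
        by (intro prod_nonneg) simp
    qed
    also have "\<dots> = (\<Prod>i\<in>(UNIV :: 'n set). \<Sum>j\<in>T. inverse (1 + j\<^sup>2))"
      using T(1) by (intro prod_sum_PiE[symmetric]) auto
    also have "\<dots> \<le> (\<Prod>i\<in>(UNIV :: 'n set). 5)"
      by (intro prod_mono conjI sum_inverse_square_Ints_le T sum_nonneg) auto
    finally show "(\<Sum>k\<in>F. inverse ((1 + (norm k)\<^sup>2) ^ CARD('n))) \<le> 5 ^ CARD('n)" by simp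
  qed
qed auto

section \<open>Growth and prescription of Fourier coefficients\<close>

text \<open>
  A functional of order \<open>N\<close> sees at most \<open>N\<close> derivatives of the exponential, each of which costs a
  factor of size \<open>2\<pi>\<bar>k\<bar>\<close>.
\<close>

lemma fourier_coeff_growth:
  fixes u :: "'n::finite distr"
  assumes u: "u \<in> distributions"
  obtains C N where "\<And>k. k \<in> int_lattice \<Longrightarrow> norm (fourier_coeff u k) \<le> C * (1 + (norm k)\<^sup>2) ^ N"
proof -
  obtain N C where C: "C > 0"
    "\<forall>\<phi>\<in>test_functions. \<forall>B>0. derivs_bounded N B \<phi> \<longrightarrow> norm (u \<phi>) \<le> C * B"
    using distribution_finite_order[OF u] by metis
  have "norm (fourier_coeff u k) \<le> C * (2 * pi) ^ N * (1 + (norm k)\<^sup>2) ^ N"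
    if k: "k \<in> int_lattice" for k
  proof -
    define b where "b = 2 * pi * (1 + (norm k)\<^sup>2)"
    have b: "b \<ge> 1"
      unfolding b_def using pi_ge_two by (intro mult_ge1_I) auto
    have k_le: "norm (freq ((- k) $ i)) \<le> b" for i
    proof -
      have "norm k \<le> 1 + (norm k)\<^sup>2"
        using sum_power2_ge_zero[of "norm k - 1/2" 0] by (simp add: power2_eq_square algebra_simps)
      with component_le_norm_cart[of k i] have "\<bar>k $ i\<bar> \<le> 1 + (norm k)\<^sup>2" by linarith
      then show ?thesis by (simp add: b_def norm_mult)
    qed
    have "derivs_bounded N (b ^ N) (torus_exp (- k))"
      unfolding derivs_bounded_def
    proof (intro allI impI)
      fix \<alpha> :: "'n list" and x :: "real^'n" assume "length \<alpha> \<le> N"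
      have "norm (\<Prod>i\<leftarrow>\<alpha>. freq ((- k) $ i)) \<le> b ^ length \<alpha>"
      proof (induction \<alpha>)
        case (Cons i \<alpha>)
        have "norm (freq ((- k) $ i)) * norm (\<Prod>i\<leftarrow>\<alpha>. freq ((- k) $ i)) \<le> b * b ^ length \<alpha>"
          by (rule mult_mono[OF k_le Cons]) (use b in auto)
        then show ?case by (simp only: list.map prod_list.Cons norm_mult list.size power_Suc add_0_right add_Suc_right)
      qed simp
      also have "\<dots> \<le> b ^ N" using b \<open>length \<alpha> \<le> N\<close> by (rule power_increasing[rotated])
      finally show "norm (pdiffs \<alpha> (torus_exp (- k)) x) \<le> b ^ N"
        by (simp add: pdiffs_torus_exp norm_mult)
    qed
    moreover have "b ^ N > 0" using b by simp
    ultimately have "norm (fourier_coeff u k) \<le> C * b ^ N"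
      using C(2) k by (simp add: fourier_coeff_def)
    then show ?thesis by (simp add: b_def power_mult_distrib mult.assoc)
  qed
  then show ?thesis by (rule that)
qed

text \<open>
  The functional is defined by Parseval's formula \<open>\<Sum>k. a k * test_coeff \<phi> (-k)\<close>. The rapid decay of
  the coefficients of a test function compensates the growth of \<open>a\<close> and leaves a summable factor; only
  finitely many derivatives of the test function enter the estimate, which gives continuity.
\<close>

lemma distribution_with_fourier_coeffs:
  fixes a :: "real^'n::finite \<Rightarrow> complex"
  assumes a: "\<And>k. k \<in> int_lattice \<Longrightarrow> norm (a k) \<le> C * (1 + (norm k)\<^sup>2) ^ N"
  obtains u :: "'n distr" where
    "u \<in> distributions" "\<And>k. k \<in> int_lattice \<Longrightarrow> fourier_coeff u k = a k"
proof -
  define n where "n = CARD('n)"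
  define q where "q = N + n"
  define w :: "real^'n \<Rightarrow> real" where "w k = inverse ((1 + (norm k)\<^sup>2) ^ n)" for k
  define u :: "'n distr" where "u \<phi> = (\<Sum>\<^sub>\<infinity>k\<in>int_lattice. a k * test_coeff \<phi> (- k))" for \<phi>
  have w: "w summable_on int_lattice"
    unfolding w_def n_def by (rule summable_int_lattice)
  have C: "C \<ge> 0"
    using a[of 0] order_trans[OF norm_ge_zero[of "a 0"]] by (simp add: int_lattice_def)
  have term_le: "norm (a k * test_coeff \<phi> (- k)) \<le> C * (1 + real n) ^ q * B * w k"
    if \<phi>: "\<phi> \<in> test_functions" "derivs_bounded (2 * q) B \<phi>" and k: "k \<in> int_lattice" for \<phi> B k
  proof -
    let ?p = "1 + (norm k)\<^sup>2"
    have p: "?p > 0" by (simp add: add_pos_nonneg)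
    have "?p ^ q * norm (test_coeff \<phi> (- k)) \<le> (1 + real n) ^ q * B"
      using test_coeff_decay[of \<phi> "- k" q B] \<phi> k by (simp add: n_def)
    then have "?p ^ N * norm (test_coeff \<phi> (- k)) \<le> (1 + real n) ^ q * B * w k"
      using p by (simp add: q_def power_add w_def field_simps)
    then have "C * (?p ^ N * norm (test_coeff \<phi> (- k))) \<le> C * ((1 + real n) ^ q * B * w k)"
      using C by (rule mult_left_mono)
    moreover have "norm (a k * test_coeff \<phi> (- k)) \<le> C * ?p ^ N * norm (test_coeff \<phi> (- k))"
      using a[OF k] by (simp add: norm_mult mult_right_mono)
    ultimately show ?thesis by (simp add: mult.assoc)
  qed
  have abs: "(\<lambda>k. norm (a k * test_coeff \<phi> (- k))) summable_on int_lattice"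
    if \<phi>: "\<phi> \<in> test_functions" for \<phi>
  proof -
    obtain B where "derivs_bounded (2 * q) B \<phi>" by (rule test_derivs_bounded[OF \<phi>])
    then show ?thesis
      using term_le \<phi>
      by (intro Infinite_Sum.abs_summable_on_comparison_test'[OF summable_on_cmult_right[OF w]]) auto
  qed
  have summ: "(\<lambda>k. a k * test_coeff \<phi> (- k)) summable_on int_lattice"
    if "\<phi> \<in> test_functions" for \<phi>
    using abs_summable_summable[OF abs[OF that]] .
  have "u \<in> distributions"
  proof (rule distributionI)
    fix \<phi> \<psi> :: "real^'n \<Rightarrow> complex" assume \<phi>: "\<phi> \<in> test_functions" "\<psi> \<in> test_functions"
    show "u (\<lambda>x. \<phi> x + \<psi> x) = u \<phi> + u \<psi>"
      using infsum_add[OF summ summ, OF \<phi>] test_coeff_lincomb[OF \<phi>, of 1 1]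
      by (simp add: u_def distrib_left)
  next
    fix c and \<phi> :: "real^'n \<Rightarrow> complex" assume \<phi>: "\<phi> \<in> test_functions"
    show "u (\<lambda>x. c * \<phi> x) = c * u \<phi>"
      using test_coeff_lincomb[OF \<phi> \<phi>, of c 0]
      by (simp add: u_def infsum_cmult_right'[symmetric] mult.left_commute)
  next
    fix \<phi> :: "real^'n \<Rightarrow> complex" and B :: real
    assume \<phi>: "\<phi> \<in> test_functions" and B: "B > 0" "derivs_bounded (2 * q) B \<phi>"
    have "norm (u \<phi>) \<le> (\<Sum>\<^sub>\<infinity>k\<in>int_lattice. norm (a k * test_coeff \<phi> (- k)))"
      unfolding u_def by (rule norm_infsum_bound[OF abs[OF \<phi>]])
    also have "\<dots> \<le> (\<Sum>\<^sub>\<infinity>k\<in>int_lattice. C * (1 + real n) ^ q * B * w k)"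
      using term_le \<phi> B by (intro infsum_mono abs summable_on_cmult_right w) auto
    also have "\<dots> = C * (1 + real n) ^ q * (\<Sum>\<^sub>\<infinity>k\<in>int_lattice. w k) * B"
      by (simp only: infsum_cmult_right') (simp only: mult_ac)
    finally show "norm (u \<phi>) \<le> C * (1 + real n) ^ q * (\<Sum>\<^sub>\<infinity>k\<in>int_lattice. w k) * B" .
  qed
  moreover have "fourier_coeff u k = a k" if k: "k \<in> int_lattice" for k
  proof -
    have "fourier_coeff u k = (\<Sum>\<^sub>\<infinity>l\<in>int_lattice. a l * (if - k = - l then 1 else 0))"
      unfolding fourier_coeff_def u_def
      using k by (intro infsum_cong) (simp add: test_coeff_torus_exp)
    also have "\<dots> = (\<Sum>\<^sub>\<infinity>l\<in>{k}. a l)"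
      using k by (intro infsum_cong_neutral) auto
    finally show ?thesis by simp
  qed
  ultimately show ?thesis by (rule that)
qed

section \<open>Distributions are determined by their Fourier coefficients\<close>

text \<open>
  The Fejer kernel, written as a sum of exponentials so that averages against it are combinations of
  averages against exponentials.
\<close>

definition fejer :: "nat \<Rightarrow> real \<Rightarrow> complex" where
  "fejer M t = (\<Sum>a\<le>M. \<Sum>b\<le>M. wave (real b - real a) t) / of_nat (Suc M)"

lemma continuous_on_fejer [continuous_intros]: "continuous_on S (fejer M)"
  unfolding fejer_def[abs_def] by (intro continuous_intros) (simp del: of_nat_Suc)

lemma fejer_eq_square:
  "fejer M t = of_real ((norm (\<Sum>a\<le>M. wave (real a) t))\<^sup>2 / real (Suc M))"
proof -
  have cnj: "cnj (wave r t) = wave (- r) t" for r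
    by (simp add: wave_def cis_cnj)
  have "complex_of_real ((norm (\<Sum>a\<le>M. wave (real a) t))\<^sup>2) =
      (\<Sum>b\<le>M. wave (real b) t) * (\<Sum>a\<le>M. wave (- real a) t)"
    by (simp only: complex_norm_square cnj_sum cnj)
  also have "\<dots> = (\<Sum>a\<le>M. \<Sum>b\<le>M. wave (real b - real a) t)"
    by (subst mult.commute) (simp add: sum_product wave_mult)
  finally show ?thesis by (simp add: fejer_def)
qed

lemma norm_fejer: "norm (fejer M t) = Re (fejer M t)"
  by (simp only: fejer_eq_square norm_of_real Re_complex_of_real) simp

lemma fejer_wave_has_integral:
  assumes "s \<in> \<int>"
  shows "((\<lambda>t. fejer M t * wave s t) has_integral
    (\<Sum>a\<le>M. \<Sum>b\<le>M. if real b - real a + s = 0 then 1 else 0) / of_nat (Suc M)) {0..1}"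
proof -
  have "((\<lambda>t. (\<Sum>a\<le>M. \<Sum>b\<le>M. wave (real b - real a + s) t) / of_nat (Suc M)) has_integral
    (\<Sum>a\<le>M. \<Sum>b\<le>M. if real b - real a + s = 0 then 1 else 0) / of_nat (Suc M)) {0..1}"
    by (intro has_integral_divide has_integral_sum finite_atMost integral_wave Ints_add Ints_diff
        Ints_of_nat assms)
  moreover have "fejer M t * wave s t = (\<Sum>a\<le>M. \<Sum>b\<le>M. wave (real b - real a + s) t) / of_nat (Suc M)" for t
    by (simp add: fejer_def sum_distrib_right wave_mult)
  ultimately show ?thesis by simp
qed

lemma fejer_has_integral: "(fejer M has_integral 1) {0..1}"
proof -
  have "(\<Sum>a\<le>M. \<Sum>b\<le>M. if real b - real a + 0 = 0 then 1 else 0) = (of_nat (Suc M) :: complex)"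
    by (simp add: sum.delta)
  with fejer_wave_has_integral[of 0 M] show ?thesis by (simp del: of_nat_Suc)
qed

text \<open>
  The mass of the kernel concentrates at the lattice points, measured by the weight \<open>sin\<^sup>2(\<pi>t)\<close>. This
  weight has only the frequencies \<open>-1\<close>, \<open>0\<close> and \<open>1\<close>, so the integral is a count of pairs \<open>(a, b)\<close>.
\<close>

lemma fejer_sin_squared_has_integral:
  "((\<lambda>t. fejer M t * of_real ((sin (pi * t))\<^sup>2)) has_integral of_real (1 / (2 * real (Suc M)))) {0..1}"
proof -
  have count: "(\<Sum>a\<le>M. if Suc a \<le> M then 1 else 0) = (of_nat M :: complex)"
  proof -
    have "(\<Sum>a\<le>M. if Suc a \<le> M then 1 else 0 :: complex) = (\<Sum>a\<in>{..M} \<inter> {a. Suc a \<le> M}. 1)"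
      by (subst sum.inter_restrict) auto
    also have "{..M} \<inter> {a. Suc a \<le> M} = {..<M}" by auto
    finally show ?thesis by simp
  qed
  have "(\<Sum>a\<le>M. \<Sum>b\<le>M. if real b - real a + (- 1) = 0 then 1 else 0) = (of_nat M :: complex)"
  proof -
    have "(real b - real a + (- 1) = 0) = (b = Suc a)" for a b by linarith
    then show ?thesis using count by (simp add: sum.delta)
  qed
  note minus = fejer_wave_has_integral[of "- 1" M, unfolded this]
  have "(\<Sum>a\<le>M. \<Sum>b\<le>M. if real b - real a + 1 = 0 then 1 else 0) = (of_nat M :: complex)"
  proof -
    have "(real b - real a + 1 = 0) = (a = Suc b)" for a b by linarith
    then show ?thesis using count by (subst sum.swap) (simp add: sum.delta)
  qed
  note plus = fejer_wave_has_integral[of 1 M, unfolded this]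
  have sin2: "complex_of_real ((sin (pi * t))\<^sup>2) = (2 - wave 1 t - wave (- 1) t) / 4" for t
  proof -
    have "wave 1 t + wave (- 1) t = of_real (2 * cos (2 * (pi * t)))"
      by (simp add: wave_def complex_eq_iff mult.assoc)
    then have "2 - wave 1 t - wave (- 1) t = of_real (2 - 2 * cos (2 * (pi * t)))"
      by (simp add: algebra_simps)
    also have "\<dots> = of_real (4 * (sin (pi * t))\<^sup>2)"
      by (simp only: cos_double_sin) simp
    finally show ?thesis by simp
  qed
  have "((\<lambda>t. (2 * fejer M t - fejer M t * wave 1 t - fejer M t * wave (- 1) t) / 4) has_integral
      (2 * 1 - of_nat M / of_nat (Suc M) - of_nat M / of_nat (Suc M)) / 4) {0..1}"
    using plus minus fejer_has_integral[of M]
    by (intro has_integral_divide has_integral_diff has_integral_mult_right) auto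
  moreover have "(2 * fejer M t - fejer M t * wave 1 t - fejer M t * wave (- 1) t) / 4 =
      fejer M t * of_real ((sin (pi * t))\<^sup>2)" for t
    unfolding sin2 by (simp add: algebra_simps)
  moreover have "(2 * 1 - of_nat M / of_nat (Suc M) - of_nat M / of_nat (Suc M)) / 4 =
      complex_of_real (1 / (2 * real (Suc M)))"
  proof -
    have "(2 * 1 - (s - 1) / s - (s - 1) / s) / 4 = 1 / (2 * s)" if "s > 0" for s :: real
      using that by (simp add: field_simps)
    moreover have "real M = real (Suc M) - 1" by simp
    ultimately have "(2 * 1 - real M / real (Suc M) - real M / real (Suc M)) / 4 = 1 / (2 * real (Suc M))"
      by (metis of_nat_0_less_iff zero_less_Suc)
    from arg_cong[OF this, of complex_of_real] show ?thesis by (simp del: of_nat_Suc)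
  qed
  ultimately show ?thesis by (simp only:)
qed

text \<open>
  Jordan's inequality, from the concavity of the sine.
\<close>

lemma min_le_sin_pi:
  fixes t :: real
  assumes "t \<in> {0..1}"
  shows "2 * min t (1 - t) \<le> sin (pi * t)"
proof -
  have *: "2 * s \<le> sin (pi * s)" if "s \<in> {0..1/2}" for s :: real
  proof -
    have "concave_on {0..1/2} (\<lambda>s. sin (pi * s))"
    proof (rule f''_le0_imp_concave)
      fix s :: real assume s: "s \<in> {0..1/2}"
      show "((\<lambda>s. sin (pi * s)) has_real_derivative pi * cos (pi * s)) (at s)"
        by (auto intro!: derivative_eq_intros)
      show "((\<lambda>s. pi * cos (pi * s)) has_real_derivative - (pi * pi * sin (pi * s))) (at s)"
        by (auto intro!: derivative_eq_intros)
      have "pi * s \<le> pi" using s mult_left_mono[of s 1 pi] by simp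
      then have "0 \<le> sin (pi * s)" using s by (intro sin_ge_zero) auto
      then show "- (pi * pi * sin (pi * s)) \<le> 0" by simp
    qed simp
    from concave_onD_Icc'[OF this that] show ?thesis by simp
  qed
  show ?thesis
  proof (cases "t \<le> 1/2")
    case True
    then show ?thesis using *[of t] assms by (simp add: min_def)
  next
    case False
    have "sin (pi * (1 - t)) = sin (pi * t)" by (simp add: right_diff_distrib)
    then show ?thesis using *[of "1 - t"] assms False by (simp add: min_def)
  qed
qed

lemma norm_diff_along_axis_le:
  fixes \<phi> :: "real^'n::finite \<Rightarrow> complex"
  assumes \<phi>: "\<phi> \<in> test_functions" and L: "\<And>x. norm (pdiff i \<phi> x) \<le> L" and "s \<le> t"
  shows "norm (\<phi> (x + t *\<^sub>R axis i 1) - \<phi> (x + s *\<^sub>R axis i 1)) \<le> L * (t - s)"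
proof -
  have "((\<lambda>t. \<phi> (x + t *\<^sub>R axis i 1)) has_vector_derivative pdiff i \<phi> (x + r *\<^sub>R axis i 1))
      (at r within {s..t})" for r
    using has_vector_derivative_along_line[OF test_differentiable[OF \<phi>], of x "axis i 1" r]
    by (simp add: axis_def if_distrib if_distribR cong: if_cong)
  then have "((\<lambda>t. pdiff i \<phi> (x + t *\<^sub>R axis i 1)) has_integral
      \<phi> (x + t *\<^sub>R axis i 1) - \<phi> (x + s *\<^sub>R axis i 1)) {s..t}"
    by (intro fundamental_theorem_of_calculus assms(3)) auto
  from has_integral_bound_real[OF _ finite.emptyI this, of L] show ?thesis
    using L order_trans[OF norm_ge_zero L] assms(3) by simp
qed

text \<open>
  By periodicity \<open>\<phi> (x + t e\<^sub>i)\<close> differs from \<open>\<phi> x\<close> by at most \<open>L * min t (1 - t)\<close>, hence by at most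
  \<open>L * sin(\<pi>t) / 2\<close>. Only the integral of the kernel against \<open>sin\<^sup>2(\<pi>t)\<close> is known, so the sine is
  estimated by \<open>2 sin(\<pi>t) \<le> e + sin\<^sup>2(\<pi>t) / e\<close>, with a parameter \<open>e\<close> that can be chosen later.
\<close>

lemma fejer_mean_close:
  fixes \<phi> :: "real^'n::finite \<Rightarrow> complex"
  assumes \<phi>: "\<phi> \<in> test_functions" and L: "\<And>x. norm (pdiff i \<phi> x) \<le> L" and e: "e > 0"
  shows "norm (\<phi> x - line_avg (fejer M) (axis i 1) \<phi> x) \<le>
    L / 4 * (e + 1 / (e * (2 * real (Suc M))))"
proof -
  let ?\<phi> = "\<lambda>t. \<phi> (x + t *\<^sub>R axis i 1)"
  have Lpos: "L \<ge> 0" using L order_trans[OF norm_ge_zero] by blast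
  have lip: "norm (\<phi> x - ?\<phi> t) \<le> L / 4 * (e + (sin (pi * t))\<^sup>2 / e)" if t: "t \<in> {0..1}" for t
  proof -
    have "norm (\<phi> x - ?\<phi> t) \<le> L * t"
      using norm_diff_along_axis_le[OF \<phi> L, of 0 t x] t by (simp add: norm_minus_commute)
    moreover have "norm (\<phi> x - ?\<phi> t) \<le> L * (1 - t)"
      using norm_diff_along_axis_le[OF \<phi> L, of t 1 x] t test_periodic[OF \<phi> axis_int_lattice] by simp
    ultimately have "norm (\<phi> x - ?\<phi> t) \<le> L * min t (1 - t)" by (simp add: min_def)
    also have "\<dots> \<le> L * (sin (pi * t) / 2)"
      using min_le_sin_pi[OF t] Lpos by (intro mult_left_mono) auto
    also have "\<dots> \<le> L * ((e + (sin (pi * t))\<^sup>2 / e) / 4)"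
    proof (intro mult_left_mono Lpos)
      have "0 \<le> (sin (pi * t) - e)\<^sup>2 / e" using e by simp
      also have "\<dots> = e + (sin (pi * t))\<^sup>2 / e - 2 * sin (pi * t)"
        using e by (simp add: field_simps power2_eq_square)
      finally show "sin (pi * t) / 2 \<le> (e + (sin (pi * t))\<^sup>2 / e) / 4" by simp
    qed
    finally show ?thesis by simp
  qed
  have "((\<lambda>t. fejer M t * \<phi> x - fejer M t * ?\<phi> t) has_integral
      1 * \<phi> x - line_avg (fejer M) (axis i 1) \<phi> x) {0..1}"
    unfolding line_avg_def
    by (intro has_integral_diff has_integral_mult_left fejer_has_integral integrable_integral
        line_avg_integrable \<phi> continuous_intros)
  then have I: "((\<lambda>t. fejer M t * (\<phi> x - ?\<phi> t)) has_integral
      \<phi> x - line_avg (fejer M) (axis i 1) \<phi> x) {0..1}"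
    by (simp add: right_diff_distrib)
  have "((\<lambda>t. of_real (L / 4 * e) * fejer M t +
        of_real (L / (4 * e)) * (fejer M t * of_real ((sin (pi * t))\<^sup>2))) has_integral
      of_real (L / 4 * e) * 1 + of_real (L / (4 * e)) * of_real (1 / (2 * real (Suc M)))) {0..1}"
    by (intro has_integral_add has_integral_mult_right fejer_has_integral
        fejer_sin_squared_has_integral)
  from has_integral_linear[OF this bounded_linear_Re]
  have J: "((\<lambda>t. Re (fejer M t) * (L / 4 * (e + (sin (pi * t))\<^sup>2 / e))) has_integral
      L / 4 * (e + 1 / (e * (2 * real (Suc M))))) {0..1}"
    by (simp add: o_def algebra_simps flip: of_real_power of_real_mult of_real_divide)
  have "norm (fejer M t * (\<phi> x - ?\<phi> t)) \<le> Re (fejer M t) * (L / 4 * (e + (sin (pi * t))\<^sup>2 / e))"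
    if "t \<in> {0..1}" for t
  proof -
    have "0 \<le> Re (fejer M t)" by (metis norm_fejer norm_ge_zero)
    then show ?thesis
      unfolding norm_mult norm_fejer by (rule mult_left_mono[OF lip[OF that]])
  qed
  from has_integral_norm_bound_integral_component[OF I J, of 1] this show ?thesis by simp
qed

lemma line_avg_fejer:
  assumes "\<phi> \<in> test_functions"
  shows "line_avg (fejer M) v \<phi> =
    (\<lambda>x. (\<Sum>(a, b)\<in>{..M} \<times> {..M}. inverse (of_nat (Suc M)) * line_avg (wave (- (real a - real b))) v \<phi> x))"
proof
  fix x
  have "((\<lambda>t. \<Sum>(a, b)\<in>{..M} \<times> {..M}. inverse (of_nat (Suc M)) *
        (wave (- (real a - real b)) t * \<phi> (x + t *\<^sub>R v))) has_integral
      (\<Sum>(a, b)\<in>{..M} \<times> {..M}. inverse (of_nat (Suc M)) * line_avg (wave (- (real a - real b))) v \<phi> x)) {0..1}"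
    unfolding line_avg_def case_prod_unfold
    by (intro has_integral_sum has_integral_mult_right integrable_integral line_avg_integrable
        assms continuous_on_wave finite_cartesian_product finite_atMost)
  moreover have "(\<Sum>(a, b)\<in>{..M} \<times> {..M}. inverse (of_nat (Suc M)) *
        (wave (- (real a - real b)) t * \<phi> (x + t *\<^sub>R v))) = fejer M t * \<phi> (x + t *\<^sub>R v)" for t
    by (simp add: fejer_def sum.cartesian_product[symmetric] sum_distrib_left sum_distrib_right
        divide_inverse mult_ac)
  ultimately show "line_avg (fejer M) v \<phi> x =
    (\<Sum>(a, b)\<in>{..M} \<times> {..M}. inverse (of_nat (Suc M)) * line_avg (wave (- (real a - real b))) v \<phi> x)"
    by (simp add: line_avg_def integral_unique)
qed

text \<open>
  Along the segment from \<open>0\<close> to \<open>x\<close>, the product of \<open>\<phi>\<close> with the exponential of opposite frequency has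
  derivative zero.
\<close>

lemma eigenfunction_eq_torus_exp:
  fixes \<phi> :: "real^'n::finite \<Rightarrow> complex"
  assumes \<phi>: "\<phi> \<in> test_functions" and eig: "\<And>i x. pdiff i \<phi> x = freq (k $ i) * \<phi> x"
  shows "\<phi> = (\<lambda>x. \<phi> 0 * torus_exp k x)"
proof
  fix x
  let ?g = "\<lambda>t. wave (- (k \<bullet> x)) t * \<phi> (0 + t *\<^sub>R x)"
  have "(\<Sum>i\<in>UNIV. of_real (x $ i) * pdiff i \<phi> y) = freq (k \<bullet> x) * \<phi> y" for y
    by (simp add: eig inner_vec_def sum_distrib_left sum_distrib_right mult_ac)
  note line = has_vector_derivative_along_line[OF test_differentiable[OF \<phi>], of 0 x, unfolded this]
  have "(?g has_vector_derivative wave (- (k \<bullet> x)) t * (freq (k \<bullet> x) * \<phi> (0 + t *\<^sub>R x)) +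
      freq (- (k \<bullet> x)) * wave (- (k \<bullet> x)) t * \<phi> (0 + t *\<^sub>R x)) (at t within {0..1})" for t
    by (intro has_vector_derivative_mult wave_has_vector_derivative line)
  then have "(?g has_vector_derivative 0) (at t within {0..1})" for t
    by simp
  then have "((\<lambda>t. 0) has_integral ?g 1 - ?g 0) {0..1}"
    using fundamental_theorem_of_calculus[of 0 1 ?g "\<lambda>_. 0"] by simp
  then have "?g 1 = ?g 0" using has_integral_unique[OF has_integral_0] by fastforce
  then have "wave (k \<bullet> x) 1 * (wave (- (k \<bullet> x)) 1 * \<phi> x) = wave (k \<bullet> x) 1 * \<phi> 0" by simp
  then show "\<phi> x = \<phi> 0 * torus_exp k x"
    by (simp add: mult.assoc[symmetric] wave_mult) (simp add: wave_def torus_exp_eq_cis)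
qed

text \<open>
  By induction on a set \<open>A\<close> of coordinates, the distribution vanishes on test functions that are pure
  oscillations in all coordinates outside \<open>A\<close>. If \<open>A\<close> is empty, such a function is a multiple of an
  exponential. To add a coordinate \<open>i\<close>, smooth the test function in direction \<open>i\<close> with a Fejer kernel:
  the result is a combination of functions to which the induction hypothesis applies. It is
  close to the original function together with any finite number of derivatives, because smoothing
  commutes with derivatives.
\<close>

lemma distribution_zero_if_fourier_coeffs_zero:
  fixes u :: "'n::finite distr"
  assumes u: "u \<in> distributions" and zero: "\<And>k. k \<in> int_lattice \<Longrightarrow> u (torus_exp k) = 0"
    and "\<phi> \<in> test_functions"
  shows "u \<phi> = 0"
proof -
  obtain N C where C: "C > 0"
    "\<forall>\<phi>\<in>test_functions. \<forall>B>0. derivs_bounded N B \<phi> \<longrightarrow> norm (u \<phi>) \<le> C * B"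
    using distribution_finite_order[OF u] by metis
  have "u \<phi> = 0"
    if "\<phi> \<in> test_functions"
      "\<And>i. i \<notin> A \<Longrightarrow> \<exists>j::int. pdiff i \<phi> = (\<lambda>x. freq (of_int j) * \<phi> x)"
    for A :: "'n set" and \<phi>
    using finite[of A] that
  proof (induction A arbitrary: \<phi> rule: finite_induct)
    case empty
    then obtain j :: "'n \<Rightarrow> int" where j: "\<And>i. pdiff i \<phi> = (\<lambda>x. freq (of_int (j i)) * \<phi> x)"
      by (metis empty_iff)
    define k :: "real^'n" where "k = (\<chi> i. of_int (j i))"
    have "k \<in> int_lattice" by (simp add: k_def int_lattice_def)
    moreover have "\<phi> = (\<lambda>x. \<phi> 0 * torus_exp k x)"
      using empty(1) by (rule eigenfunction_eq_torus_exp) (simp add: j k_def)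
    ultimately show ?case using distribution_scale[OF u torus_exp_test, of k "\<phi> 0"] zero by simp
  next
    case (insert i A)
    obtain L where L: "L > 0" "derivs_bounded (Suc N) L \<phi>"
      by (rule test_derivs_bounded[OF insert.prems(1)])
    have mode: "u (line_avg (wave (- real_of_int j)) (axis i 1) \<phi>) = 0" for j
    proof (rule insert.IH)
      let ?\<psi> = "line_avg (wave (- real_of_int j)) (axis i 1) \<phi>"
      show "?\<psi> \<in> test_functions" by (intro line_avg_test continuous_on_wave insert.prems)
      fix l assume l: "l \<notin> A"
      show "\<exists>j::int. pdiff l ?\<psi> = (\<lambda>x. freq (of_int j) * ?\<psi> x)"
      proof (cases "l = i")
        case True
        have "pdiff i ?\<psi> x = freq (of_int j) * ?\<psi> x" for x
          using line_avg_wave_deriv[OF insert.prems(1) axis_int_lattice, of "of_int j" i x]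
          by (simp add: axis_def if_distrib if_distribR cong: if_cong)
        then show ?thesis using True by blast
      next
        case False
        then obtain j' :: int where "pdiff l \<phi> = (\<lambda>x. freq (of_int j') * \<phi> x)"
          using insert.prems(2) l by blast
        then have "pdiff l ?\<psi> = (\<lambda>x. freq (of_int j') * ?\<psi> x)"
          using pdiff_line_avg[OF continuous_on_wave insert.prems(1)]
            line_avg_lincomb[OF continuous_on_wave insert.prems(1) insert.prems(1),
              where a = "freq (of_int j')" and b = 0] by simp
        then show ?thesis by blast
      qed
    qed
    have fejer_zero: "u (line_avg (fejer M) (axis i 1) \<phi>) = 0" for M
    proof -
      have *: "line_avg (wave (- (real a - real b))) (axis i 1) \<phi> \<in> test_functions" for a b
        by (intro line_avg_test continuous_on_wave insert.prems)
      have "u (line_avg (wave (- (real a - real b))) (axis i 1) \<phi>) = 0" for a b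
        using mode[of "int a - int b"] by simp
      then show ?thesis
        unfolding line_avg_fejer[OF insert.prems(1)] case_prod_unfold
        by (subst distribution_sum[OF u]) (simp_all only: * test_scale distribution_scale[OF u] mult_zero_right sum.neutral_const)
    qed
    have small: "norm (u \<phi>) \<le> C * (L * e)" if e: "e > 0" for e
    proof -
      obtain M where M: "1 / e\<^sup>2 < real M" using reals_Archimedean2 by blast
      have M': "1 / (e * (2 * real (Suc M))) \<le> e"
      proof -
        have "1 < real M * e\<^sup>2" using M e by (simp add: field_simps)
        also have "\<dots> \<le> 2 * real (Suc M) * e\<^sup>2" by (intro mult_right_mono) auto
        finally have "1 \<le> e * (e * (2 * real (Suc M)))" by (simp add: power2_eq_square mult_ac)
        then show ?thesis using e by (simp add: divide_le_eq del: of_nat_Suc)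
      qed
      let ?F = "line_avg (fejer M) (axis i 1)"
      have F: "?F \<phi> \<in> test_functions" by (intro line_avg_test continuous_on_fejer insert.prems)
      have "derivs_bounded N (L * e) (\<lambda>x. \<phi> x - ?F \<phi> x)"
        unfolding derivs_bounded_def
      proof (intro allI impI)
        fix \<alpha> :: "'n list" and x :: "real^'n" assume "length \<alpha> \<le> N"
        then have "norm (pdiff i (pdiffs \<alpha> \<phi>) x) \<le> L" for x
          using L(2) unfolding derivs_bounded_def by (auto dest: spec[of _ "i # \<alpha>"])
        from fejer_mean_close[OF pdiffs_test[OF insert.prems(1)] this e, of x M]
        have "norm (pdiffs \<alpha> \<phi> x - ?F (pdiffs \<alpha> \<phi>) x) \<le> L / 4 * (e + 1 / (e * (2 * real (Suc M))))" .
        also have "\<dots> \<le> L / 4 * (e + e)" using M' L by (intro mult_left_mono) auto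
        also have "\<dots> \<le> L * e" using L e by simp
        finally show "norm (pdiffs \<alpha> (\<lambda>x. \<phi> x - ?F \<phi> x) x) \<le> L * e"
          using insert.prems(1) F
          by (simp add: pdiffs_diff pdiffs_line_avg continuous_on_fejer)
      qed
      then have "norm (u (\<lambda>x. \<phi> x - ?F \<phi> x)) \<le> C * (L * e)"
        using C(2) test_diff[OF insert.prems(1) F] L e by simp
      then show ?thesis
        using distribution_diff[OF u insert.prems(1) F] fejer_zero by simp
    qed
    have "norm (u \<phi>) \<le> 0 + d" if "d > 0" for d
      using small[of "d / (C * L)"] that C L by simp
    then have "norm (u \<phi>) \<le> 0" by (rule field_le_epsilon)
    then show ?case by simp
  qed
  from this[of \<phi> UNIV] assms(3) show ?thesis by simp
qed

lemma distribution_eq_if_fourier_coeffs_eq: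
  fixes u w :: "'n::finite distr"
  assumes "u \<in> distributions" "w \<in> distributions"
    and "\<And>k. k \<in> int_lattice \<Longrightarrow> fourier_coeff u k = fourier_coeff w k"
    and "\<phi> \<in> test_functions"
  shows "u \<phi> = w \<phi>"
proof -
  have "u (torus_exp k) - w (torus_exp k) = 0" if "k \<in> int_lattice" for k
    using assms(3)[of "- k"] that by (simp add: fourier_coeff_def)
  then show ?thesis
    using distribution_zero_if_fourier_coeffs_zero[OF distribution_lincomb[OF assms(1,2), of 1 "- 1"] _ assms(4)]
    by simp
qed

section \<open>Contractions of symmetric tensors\<close>

definition contract :: "real^'n::finite \<Rightarrow> ('n list \<Rightarrow> complex) \<Rightarrow> 'n list \<Rightarrow> complex" where
  "contract w F I = (\<Sum>i\<in>UNIV. of_real (w $ i) * F (i # I))"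

text \<open>
  Symmetry is required for lists of all lengths, so that it is inherited by contractions without
  reference to the order of the tensor.
\<close>

definition perm_invariant :: "('n list \<Rightarrow> complex) \<Rightarrow> bool" where
  "perm_invariant F \<longleftrightarrow> (\<forall>I J. mset I = mset J \<longrightarrow> F I = F J)"

lemma contract_lincomb:
  "contract w (\<lambda>I. a * F I + b * G I) = (\<lambda>I. a * contract w F I + b * contract w G I)"
  by (simp add: contract_def fun_eq_iff sum.distrib sum_distrib_left algebra_simps)

lemma contract_add_scaleR:
  "contract (a *\<^sub>R v + b *\<^sub>R w) F = (\<lambda>I. of_real a * contract v F I + of_real b * contract w F I)"
  by (simp add: contract_def fun_eq_iff sum.distrib sum_distrib_left algebra_simps)

lemma contract_axis: "contract (axis i 1) F I = F (i # I)"
  by (simp add: contract_def axis_def if_distrib if_distribR cong: if_cong)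

lemma contract_power_lincomb:
  "(contract w ^^ n) (\<lambda>I. a * F I + b * G I) =
    (\<lambda>I. a * (contract w ^^ n) F I + b * (contract w ^^ n) G I)"
  by (induction n) (simp_all add: contract_lincomb)

lemma perm_invariant_contract: "perm_invariant F \<Longrightarrow> perm_invariant (contract w F)"
  unfolding perm_invariant_def contract_def
  by (intro allI impI sum.cong refl arg_cong2[where f = "(*)"]) (simp del: mset.simps(1))

lemma contract_commute:
  assumes "perm_invariant F"
  shows "contract v (contract w F) = contract w (contract v F)"
proof
  fix I
  have swap: "F (j # i # I) = F (i # j # I)" for i j
    using assms by (simp add: perm_invariant_def add_mset_commute)
  have "contract v (contract w F) I =
      (\<Sum>i\<in>UNIV. \<Sum>j\<in>UNIV. of_real (v $ i) * of_real (w $ j) * F (i # j # I))"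
    by (simp add: contract_def sum_distrib_left mult.assoc swap)
  also have "\<dots> = (\<Sum>j\<in>UNIV. \<Sum>i\<in>UNIV. of_real (v $ i) * of_real (w $ j) * F (i # j # I))"
    by (rule sum.swap)
  also have "\<dots> = contract w (contract v F) I"
    by (simp add: contract_def sum_distrib_left mult_ac)
  finally show "contract v (contract w F) I = contract w (contract v F) I" .
qed

lemma contract_power_commute:
  "perm_invariant F \<Longrightarrow> (contract v ^^ n) (contract w F) = contract w ((contract v ^^ n) F)"
proof (induction n arbitrary: F)
  case (Suc n)
  show ?case
    unfolding funpow_Suc_right o_apply contract_commute[OF Suc.prems, of v w]
    by (rule Suc.IH[OF perm_invariant_contract[OF Suc.prems]])
qed simp

text \<open>
  The value of \<open>F\<close> on the diagonal at \<open>v + j w\<close> is a polynomial in \<open>j\<close>. Its linear coefficient is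
  \<open>n\<close> times the value with one argument \<open>w\<close> and otherwise \<open>v\<close>; the constant coefficient is needed for the
  induction.
\<close>

lemma contract_power_along_line:
  assumes "perm_invariant F"
  shows "\<exists>p. (\<forall>j::nat. poly p (of_nat j) = (contract (v + real j *\<^sub>R w) ^^ n) F I) \<and>
    coeff p 0 = (contract v ^^ n) F I \<and>
    coeff p 1 = of_nat n * contract w ((contract v ^^ (n - 1)) F) I"
  using assms
proof (induction n arbitrary: F)
  case 0
  then show ?case by (intro exI[of _ "[:F I:]"]) simp
next
  case (Suc n)
  from Suc.IH[OF perm_invariant_contract[OF Suc.prems, of v]] obtain p where p:
    "\<And>j::nat. poly p (of_nat j) = (contract (v + real j *\<^sub>R w) ^^ n) (contract v F) I"
    "coeff p 0 = (contract v ^^ n) (contract v F) I"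
    "coeff p 1 = of_nat n * contract w ((contract v ^^ (n - 1)) (contract v F)) I"
    by blast
  from Suc.IH[OF perm_invariant_contract[OF Suc.prems, of w]] obtain q where q:
    "\<And>j::nat. poly q (of_nat j) = (contract (v + real j *\<^sub>R w) ^^ n) (contract w F) I"
    "coeff q 0 = (contract v ^^ n) (contract w F) I"
    by blast
  have "poly (p + pCons 0 q) (of_nat j) = (contract (v + real j *\<^sub>R w) ^^ Suc n) F I" for j :: nat
  proof -
    have "contract (v + real j *\<^sub>R w) F = (\<lambda>I. 1 * contract v F I + of_nat j * contract w F I)"
      using contract_add_scaleR[of 1 v "real j" w F] by simp
    then show ?thesis
      unfolding funpow_Suc_right o_apply
      by (simp only: contract_power_lincomb) (simp add: p(1) q(1))
  qed
  moreover have "coeff (p + pCons 0 q) 0 = (contract v ^^ Suc n) F I"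
    unfolding funpow_Suc_right o_apply by (simp add: p(2))
  moreover have "coeff (p + pCons 0 q) 1 =
      of_nat (Suc n) * contract w ((contract v ^^ (Suc n - 1)) F) I"
  proof -
    have "of_nat n * contract w ((contract v ^^ (n - 1)) (contract v F)) I =
        of_nat n * contract w ((contract v ^^ n) F) I"
    proof (cases n)
      case (Suc n')
      then show ?thesis unfolding Suc funpow_Suc_right o_apply by simp
    qed simp
    moreover have "(contract v ^^ n) (contract w F) I = contract w ((contract v ^^ n) F) I"
      by (simp add: contract_power_commute[OF Suc.prems])
    ultimately show ?thesis
      using p(3) q(2) by (simp add: distrib_right)
  qed
  ultimately show ?case by blast
qed

text \<open>
  A polynomial that vanishes at all natural numbers is zero, in particular its linear coefficient.
\<close>

lemma polarization_step:
  assumes F: "perm_invariant F"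
    and zero: "\<And>j::nat. (contract (v + real j *\<^sub>R w) ^^ Suc n) F I = 0"
  shows "(contract v ^^ n) (contract w F) I = 0"
proof -
  obtain p where p: "\<And>j::nat. poly p (of_nat j) = (contract (v + real j *\<^sub>R w) ^^ Suc n) F I"
    "coeff p 1 = of_nat (Suc n) * contract w ((contract v ^^ (Suc n - 1)) F) I"
    using contract_power_along_line[OF F, where v = v and w = w and n = "Suc n" and I = I] by blast
  have "range (of_nat :: nat \<Rightarrow> complex) \<subseteq> {x. poly p x = 0}"
    using p(1) zero by auto
  then have "infinite {x. poly p x = 0}"
    using infinite_super range_inj_infinite inj_of_nat by metis
  then have "p = 0" using poly_roots_finite by blast
  then have "contract w ((contract v ^^ n) F) I = 0"
    using p(2) by (simp del: of_nat_Suc)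
  then show ?thesis by (simp add: contract_power_commute[OF F])
qed

text \<open>
  The arguments are moved off the diagonal one at a time. Each step evaluates the tensor only at
  vectors \<open>v + j w\<close> with natural \<open>j\<close>, so the vectors may be restricted to a lattice.
\<close>

lemma polarization:
  assumes "perm_invariant F" and "set ws \<subseteq> M" and "M \<noteq> {}"
    and closed: "\<And>v w j. v \<in> M \<Longrightarrow> w \<in> M \<Longrightarrow> v + real j *\<^sub>R w \<in> M"
    and "\<And>v. v \<in> M \<Longrightarrow> (contract v ^^ length ws) F I = 0"
  shows "fold contract ws F I = 0"
  using assms(1,2,5)
proof (induction ws arbitrary: F)
  case Nil
  then show ?case using assms(3) by auto
next
  case (Cons w ws)
  have "(contract v ^^ length ws) (contract w F) I = 0" if "v \<in> M" for v
    using Cons.prems that closed by (intro polarization_step) auto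
  then have "fold contract ws (contract w F) I = 0"
    using Cons.prems by (intro Cons.IH perm_invariant_contract) auto
  then show ?case by simp
qed

lemma finite_lists_of_length: "finite {I :: 'n::finite list. length I = n}"
  using finite_lists_length_eq[of "UNIV :: 'n set" n] by simp

lemma sum_lists_Suc:
  fixes f :: "'n::finite list \<Rightarrow> 'b::comm_monoid_add"
  shows "(\<Sum>I | length I = Suc n. f I) = (\<Sum>i\<in>UNIV. \<Sum>I | length I = n. f (i # I))"
proof -
  have "{I :: 'n list. length I = Suc n} = (\<lambda>(i, I). i # I) ` (UNIV \<times> {I. length I = n})"
    by (auto simp: length_Suc_conv image_iff)
  then have "(\<Sum>I | length I = Suc n. f I) = (\<Sum>(i, I)\<in>UNIV \<times> {I. length I = n}. f (i # I))"
    by (simp add: sum.reindex inj_on_def case_prod_unfold)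
  then show ?thesis by (simp add: sum.cartesian_product)
qed

lemma contract_power_eq_sum:
  "(contract v ^^ n) F J = (\<Sum>I | length I = n. F (I @ J) * of_real (\<Prod>i\<leftarrow>I. v $ i))"
proof (induction n arbitrary: F)
  case (Suc n)
  have "(contract v ^^ Suc n) F J = (\<Sum>I | length I = n. contract v F (I @ J) * of_real (\<Prod>i\<leftarrow>I. v $ i))"
    unfolding funpow_Suc_right o_apply Suc ..
  also have "\<dots> = (\<Sum>I | length I = n. \<Sum>i\<in>UNIV. F ((i # I) @ J) * of_real (\<Prod>i\<leftarrow>i # I. v $ i))"
    by (simp add: contract_def sum_distrib_left mult_ac)
  also have "\<dots> = (\<Sum>i\<in>UNIV. \<Sum>I | length I = n. F ((i # I) @ J) * of_real (\<Prod>i\<leftarrow>i # I. v $ i))"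
    by (rule sum.swap)
  finally show ?case by (simp only: sum_lists_Suc)
qed simp

section \<open>Division of a symmetric tensor by a vector\<close>

text \<open>
  The orthogonal projection of the basis vector \<open>e\<^sub>i\<close> to the complement of \<open>k\<close>, multiplied by \<open>\<bar>k\<bar>\<^sup>2\<close> so that
  it is an integer vector if \<open>k\<close> is one.
\<close>

definition tangential :: "real^'n::finite \<Rightarrow> 'n \<Rightarrow> real^'n" where
  "tangential k i = (norm k)\<^sup>2 *\<^sub>R axis i 1 - (k $ i) *\<^sub>R k"

abbreviation contract_tangential ::
    "real^'n::finite \<Rightarrow> 'n list \<Rightarrow> ('n list \<Rightarrow> complex) \<Rightarrow> 'n list \<Rightarrow> complex" where
  "contract_tangential k \<equiv> fold (\<lambda>i. contract (tangential k i))"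

text \<open>
  The contribution of the step that replaces argument number \<open>j\<close>, counted from \<open>0\<close>, by its projection:
  the arguments before it are projected already, it is itself replaced by \<open>k\<close>, and those
  after it are still basis vectors. The power of \<open>\<bar>k\<bar>\<^sup>2\<close> accounts for the scaling of \<open>tangential\<close>.
\<close>

definition quotient_term ::
    "nat \<Rightarrow> real^'n::finite \<Rightarrow> ('n list \<Rightarrow> complex) \<Rightarrow> nat \<Rightarrow> 'n list \<Rightarrow> complex" where
  "quotient_term m k F j J =
     of_real ((norm k)\<^sup>2 ^ (m - 1 - j)) * contract k (contract_tangential k (take j J) F) (drop j J)"

text \<open>
  For \<open>k = 0\<close> and \<open>m \<ge> 1\<close> the division by zero makes this zero.
\<close>

definition tensor_quotient ::
    "nat \<Rightarrow> real^'n::finite \<Rightarrow> ('n list \<Rightarrow> complex) \<Rightarrow> 'n list \<Rightarrow> complex" where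
  "tensor_quotient m k F J = (\<Sum>j<m. quotient_term m k F j J) / of_real ((norm k)\<^sup>2 ^ m)"

text \<open>
  The decomposition of \<open>\<bar>k\<bar>\<^sup>2 e\<^sub>i\<close> into its components orthogonal and parallel to \<open>k\<close>.
\<close>

lemma norm_power2_mult_component:
  "of_real ((norm k)\<^sup>2) * F (i # I) = contract (tangential k i) F I + of_real (k $ i) * contract k F I"
  using contract_add_scaleR[of "(norm k)\<^sup>2" "axis i 1" "- (k $ i)" k F]
  by (simp add: tangential_def contract_axis)

text \<open>
  Projecting the arguments from left to right gives a telescoping sum from \<open>\<bar>k\<bar>\<close> to the power \<open>2 * m\<close>
  times \<open>F I\<close> to zero; the difference at step \<open>j\<close> comes from
  the component parallel to \<open>k\<close> of the basis vector at position \<open>j\<close>.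
\<close>

lemma telescope_components:
  assumes "length I = m" and "contract_tangential k I F [] = 0"
  shows "of_real ((norm k)\<^sup>2 ^ m) * F I =
    (\<Sum>j<m. of_real (k $ (I ! j)) * quotient_term m k F j (take j I @ drop (Suc j) I))"
proof -
  define A where "A j = of_real ((norm k)\<^sup>2 ^ (m - j)) * contract_tangential k (take j I) F (drop j I)" for j
  have "A j - A (Suc j) = of_real (k $ (I ! j)) * quotient_term m k F j (take j I @ drop (Suc j) I)"
    if "j < m" for j
  proof -
    let ?G = "contract_tangential k (take j I) F"
    have drop: "drop j I = I ! j # drop (Suc j) I"
      using that assms(1) by (simp add: Cons_nth_drop_Suc)
    have take: "take (Suc j) I = take j I @ [I ! j]"
      using that assms(1) by (simp add: take_Suc_conv_app_nth)
    have pow: "(norm k)\<^sup>2 ^ (m - j) = (norm k)\<^sup>2 ^ (m - 1 - j) * (norm k)\<^sup>2"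
      using that by (metis One_nat_def Suc_diff_Suc diff_commute diff_Suc_1 mult.commute power_Suc diff_Suc_eq_diff_pred)
    have "A j = of_real ((norm k)\<^sup>2 ^ (m - 1 - j)) * (of_real ((norm k)\<^sup>2) * ?G (I ! j # drop (Suc j) I))"
      unfolding A_def drop pow by (simp add: mult.assoc)
    moreover have "A (Suc j) = of_real ((norm k)\<^sup>2 ^ (m - 1 - j)) *
        contract (tangential k (I ! j)) ?G (drop (Suc j) I)"
      unfolding A_def take by simp
    ultimately have "A j - A (Suc j) = of_real ((norm k)\<^sup>2 ^ (m - 1 - j)) *
        (of_real (k $ (I ! j)) * contract k ?G (drop (Suc j) I))"
      unfolding norm_power2_mult_component by (simp add: algebra_simps)
    then show ?thesis
      using that assms(1) by (simp add: quotient_term_def mult_ac)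
  qed
  then have "(\<Sum>j<m. of_real (k $ (I ! j)) * quotient_term m k F j (take j I @ drop (Suc j) I)) =
      (\<Sum>j<m. A j - A (Suc j))" by simp
  also have "\<dots> = A 0 - A m" by (rule sum_lessThan_telescope')
  also have "\<dots> = of_real ((norm k)\<^sup>2 ^ m) * F I"
    using assms by (simp add: A_def)
  finally show ?thesis ..
qed

text \<open>
  Moving position \<open>j\<close> to the front is a permutation that does not depend on the entries of
  the list, so symmetrization absorbs it. The permutation is read off from its action on \<open>[0..<m]\<close>.
\<close>

lemma sum_permutations_move_to_front:
  fixes g :: "'a list \<Rightarrow> 'b::comm_monoid_add"
  assumes "j < m" "length I = m"
  defines "front \<equiv> \<lambda>L. L ! j # take j L @ drop (Suc j) L"
  shows "(\<Sum>p | p permutes {..<m}. g (front (permute_list p I))) =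
    (\<Sum>p | p permutes {..<m}. g (permute_list p I))"
proof -
  have front_map: "front (map h [0..<m]) = map h ([0..<m] ! j # take j [0..<m] @ drop (Suc j) [0..<m])"
    for h :: "nat \<Rightarrow> 'a"
    using assms(1) by (simp add: front_def take_map drop_map)
  have "mset (take j [0..<m] @ [0..<m] ! j # drop (Suc j) [0..<m]) = mset [0..<m]"
    by (rule arg_cong[where f = mset], rule id_take_nth_drop[symmetric]) (use assms(1) in simp)
  then have "mset ([0..<m] ! j # take j [0..<m] @ drop (Suc j) [0..<m]) = mset [0..<m]"
    by simp
  then obtain q where q: "q permutes {..<length [0..<m]}"
    "permute_list q [0..<m] = [0..<m] ! j # take j [0..<m] @ drop (Suc j) [0..<m]"
    by (rule mset_eq_permutation)
  then have qm: "q permutes {..<m}" by simp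
  have front: "front L = permute_list q L" if "length L = m" for L
  proof -
    have L: "L = map ((!) L) [0..<m]" using that by (metis map_nth)
    have "permute_list q L = map ((!) L) (permute_list q [0..<m])"
      by (subst L, rule permute_list_map) (use qm in simp)
    also have "\<dots> = front (map ((!) L) [0..<m])" unfolding front_map q(2) ..
    finally show ?thesis using L by simp
  qed
  have "(\<Sum>p | p permutes {..<m}. g (front (permute_list p I))) =
      (\<Sum>p | p permutes {..<m}. g (permute_list (p \<circ> q) I))"
    using assms(2) qm by (intro sum.cong) (simp_all add: front permute_list_compose)
  also have "\<dots> = (\<Sum>p | p permutes {..<m}. g (permute_list p I))"
    by (rule sum_permutations_compose_right[OF qm, symmetric])
  finally show ?thesis .
qed

text \<open>
  After symmetrization, the index of \<open>k\<close> in each term of \<open>telescope_components\<close> can be moved to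
  the front, and then all terms have the form \<open>k \<otimes> H\<close>.
\<close>

lemma quotient_works:
  assumes F: "perm_invariant F" and "k \<noteq> 0" and I: "length I = m"
    and zero: "\<And>I. length I = m \<Longrightarrow> contract_tangential k I F [] = 0"
  shows "F I = (\<Sum>p | p permutes {..<m}.
    of_real (k $ hd (permute_list p I)) * tensor_quotient m k F (tl (permute_list p I))) / fact m"
proof -
  define K where "K = complex_of_real ((norm k)\<^sup>2 ^ m)"
  have K: "K \<noteq> 0" using assms(2) by (simp add: K_def)
  define g where "g j L = of_real (k $ hd L) * quotient_term m k F j (tl L)" for j L
  have "fact m * (K * F I) = (\<Sum>p | p permutes {..<m}. K * F (permute_list p I))"
  proof -
    have "F (permute_list p I) = F I" if "p permutes {..<m}" for p
      using F that I unfolding perm_invariant_def by (metis mset_permute_list)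
    then have "(\<Sum>p | p permutes {..<m}. K * F (permute_list p I)) = (\<Sum>p | p permutes {..<m}. K * F I)"
      by (intro sum.cong) auto
    then show ?thesis by (simp add: card_permutations[of "{..<m}" m])
  qed
  also have "\<dots> = (\<Sum>p | p permutes {..<m}. \<Sum>j<m. g j (permute_list p I ! j #
      take j (permute_list p I) @ drop (Suc j) (permute_list p I)))"
    using I unfolding K_def g_def by (intro sum.cong refl, subst telescope_components) (auto simp: zero)
  also have "\<dots> = (\<Sum>j<m. \<Sum>p | p permutes {..<m}. g j (permute_list p I))"
    by (subst sum.swap) (simp add: sum_permutations_move_to_front I)
  also have "\<dots> = (\<Sum>p | p permutes {..<m}. \<Sum>j<m. g j (permute_list p I))"
    by (rule sum.swap)
  also have "\<dots> = (\<Sum>p | p permutes {..<m}. of_real (k $ hd (permute_list p I)) *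
      (K * tensor_quotient m k F (tl (permute_list p I))))"
  proof -
    have "K * tensor_quotient m k F J = (\<Sum>j<m. quotient_term m k F j J)" for J
      using K by (simp only: tensor_quotient_def K_def[symmetric]) simp
    then show ?thesis by (simp only: g_def sum_distrib_left)
  qed
  also have "\<dots> = K * (\<Sum>p | p permutes {..<m}.
      of_real (k $ hd (permute_list p I)) * tensor_quotient m k F (tl (permute_list p I)))"
    by (simp add: sum_distrib_left mult_ac)
  finally have "fact m * F I = (\<Sum>p | p permutes {..<m}.
      of_real (k $ hd (permute_list p I)) * tensor_quotient m k F (tl (permute_list p I)))"
    using K by (simp add: mult.left_commute)
  then show ?thesis by (simp add: field_simps)
qed

lemma norm_contract_le:
  fixes w :: "real^'n::finite"
  assumes "\<And>I. norm (F I) \<le> A"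
  shows "norm (contract w F I) \<le> real CARD('n) * norm w * A"
proof -
  have "norm (contract w F I) \<le> (\<Sum>i\<in>UNIV. norm (of_real (w $ i) * F (i # I)))"
    unfolding contract_def by (rule norm_sum)
  also have "\<dots> \<le> (\<Sum>i\<in>(UNIV :: 'n set). norm w * A)"
    unfolding norm_mult
    using component_le_norm_cart[of w] assms by (intro sum_mono mult_mono) auto
  finally show ?thesis by simp
qed

lemma norm_contract_tangential_le:
  fixes k :: "real^'n::finite"
  assumes "\<And>I. norm (F I) \<le> A"
  shows "norm (contract_tangential k is F I) \<le> (2 * real CARD('n) * (norm k)\<^sup>2) ^ length is * A"
  using assms
proof (induction "is" arbitrary: F A)
  case (Cons i "is")
  have "norm (tangential k i) \<le> norm ((norm k)\<^sup>2 *\<^sub>R axis i (1::real) :: real^'n) + norm ((k $ i) *\<^sub>R k)"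
    unfolding tangential_def by (rule norm_triangle_ineq4)
  also have "\<dots> \<le> (norm k)\<^sup>2 + norm k * norm k"
    using component_le_norm_cart[of k i] by (intro add_mono) (simp_all add: mult_right_mono)
  finally have t: "norm (tangential k i) \<le> 2 * (norm k)\<^sup>2" by (simp add: power2_eq_square)
  have "A \<ge> 0" using Cons.prems order_trans[OF norm_ge_zero] by blast
  have "norm (contract (tangential k i) F I) \<le> 2 * real CARD('n) * (norm k)\<^sup>2 * A" for I
  proof -
    have "norm (contract (tangential k i) F I) \<le> real CARD('n) * norm (tangential k i) * A"
      by (rule norm_contract_le) (rule Cons.prems)
    also have "\<dots> \<le> real CARD('n) * (2 * (norm k)\<^sup>2) * A"
      using t \<open>A \<ge> 0\<close> by (intro mult_right_mono mult_left_mono) auto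
    finally show ?thesis by (simp add: mult_ac)
  qed
  from Cons.IH[OF this] show ?case by (simp add: mult_ac)
qed simp

text \<open>
  Each contraction with \<open>tangential k i\<close> costs a factor \<open>\<bar>k\<bar>\<^sup>2\<close> up to a constant, and the contraction with
  \<open>k\<close> costs \<open>\<bar>k\<bar>\<close>. Together the numerator has degree \<open>2 * m - 1\<close> in \<open>\<bar>k\<bar>\<close>, one less than the denominator.
\<close>

lemma norm_quotient_le:
  fixes k :: "real^'n::finite"
  assumes "\<And>I. norm (F I) \<le> A" and "m \<ge> 1" and "length J = m - 1"
  shows "norm (tensor_quotient m k F J) \<le> (\<Sum>j<m. real CARD('n) * (2 * real CARD('n)) ^ j) * A / norm k"
proof (cases "k = 0")
  case True
  then show ?thesis using assms(2) by (simp add: tensor_quotient_def)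
next
  case False
  define K where "K = (norm k)\<^sup>2"
  have K: "K > 0" using False by (simp add: K_def)
  have "A \<ge> 0" using assms(1) order_trans[OF norm_ge_zero] by blast
  have "norm (quotient_term m k F j J) \<le> real CARD('n) * (2 * real CARD('n)) ^ j * (A * norm k * K ^ (m - 1))"
    if "j < m" for j
  proof -
    have "norm (quotient_term m k F j J) =
        K ^ (m - 1 - j) * norm (contract k (contract_tangential k (take j J) F) (drop j J))"
      using K by (simp add: quotient_term_def norm_mult norm_power K_def)
    also have "\<dots> \<le> K ^ (m - 1 - j) * (real CARD('n) * norm k * ((2 * real CARD('n) * K) ^ length (take j J) * A))"
      unfolding K_def
      by (intro mult_left_mono norm_contract_le norm_contract_tangential_le assms(1)) auto
    finally have *: "norm (quotient_term m k F j J) \<le>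
        K ^ (m - 1 - j) * (real CARD('n) * norm k * ((2 * real CARD('n) * K) ^ length (take j J) * A))" .
    also have "\<dots> = real CARD('n) * (2 * real CARD('n)) ^ j * (A * norm k * (K ^ (m - 1 - j) * K ^ j))"
      using that assms(3) by (simp add: power_mult_distrib mult_ac)
    also have "K ^ (m - 1 - j) * K ^ j = K ^ (m - 1)"
      using that by (simp flip: power_add)
    finally show ?thesis .
  qed
  then have "(\<Sum>j<m. norm (quotient_term m k F j J)) \<le>
      (\<Sum>j<m. real CARD('n) * (2 * real CARD('n)) ^ j * (A * norm k * K ^ (m - 1)))"
    by (intro sum_mono) auto
  then have "norm (\<Sum>j<m. quotient_term m k F j J) \<le>
      (\<Sum>j<m. real CARD('n) * (2 * real CARD('n)) ^ j) * (A * norm k * K ^ (m - 1))"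
    unfolding sum_distrib_right by (rule order_trans[OF norm_sum])
  then have "norm (\<Sum>j<m. quotient_term m k F j J) / K ^ m \<le>
      (\<Sum>j<m. real CARD('n) * (2 * real CARD('n)) ^ j) * (A * norm k * K ^ (m - 1)) / K ^ m"
    using K by (intro divide_right_mono) auto
  moreover have "norm (tensor_quotient m k F J) = norm (\<Sum>j<m. quotient_term m k F j J) / K ^ m"
    using K by (simp add: tensor_quotient_def norm_divide norm_power K_def)
  moreover have "A * norm k * K ^ (m - 1) / K ^ m = A / norm k"
  proof -
    have "K ^ m = K ^ (m - 1) * (norm k * norm k)"
      using assms(2) by (metis K_def mult.commute power2_eq_square power_eq_if not_one_le_zero)
    then show ?thesis using False K by (simp add: field_simps)
  qed
  ultimately show ?thesis by (simp add: times_divide_eq_right[symmetric] del: times_divide_eq_right)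
qed

section \<open>Symmetrized derivatives have vanishing Radon transform\<close>

lemma prod_list_permute_list:
  fixes f :: "'a \<Rightarrow> 'b::comm_monoid_mult"
  assumes "p permutes {..<length I}"
  shows "(\<Prod>i\<leftarrow>permute_list p I. f i) = (\<Prod>i\<leftarrow>I. f i)"
  using assms by (metis mset_map mset_permute_list prod_mset_prod_list)

lemma sum_permute_list:
  fixes g :: "'n::finite list \<Rightarrow> 'b::comm_monoid_add"
  assumes p: "p permutes {..<m}"
  shows "(\<Sum>I | length I = m. g (permute_list p I)) = (\<Sum>I | length I = m. g I)"
proof (rule sum.reindex_bij_witness[where i = "permute_list (inv p)" and j = "permute_list p"])
  have p': "inv p permutes {..<m}" using p by (rule permutes_inv)
  fix I :: "'n list" assume "I \<in> {I. length I = m}"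
  then have I: "length I = m" by simp
  show "permute_list (inv p) (permute_list p I) = I"
    using permute_list_compose[of "inv p" I p] p p' I by (simp add: permutes_inv_o)
  show "permute_list p (permute_list (inv p) I) = I"
    using permute_list_compose[of p I "inv p"] p p' I by (simp add: permutes_inv_o)
qed auto

lemma radon_test_test: "\<eta> \<in> test_functions \<Longrightarrow> radon_test \<eta> v \<in> test_functions"
  unfolding radon_test_eq_line_avg by (intro line_avg_test continuous_on_const)

lemma radon_test_deriv_along:
  assumes "\<eta> \<in> test_functions" "v \<in> int_lattice"
  shows "(\<Sum>i\<in>UNIV. of_real (v $ i) * pdiff i (radon_test \<eta> v) x) = 0"
proof -
  have "wave (- 0) = (\<lambda>_. 1)" by (simp add: fun_eq_iff)
  then show ?thesis
    using line_avg_wave_deriv[OF assms, of 0 x] by (simp add: radon_test_eq_line_avg)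
qed

text \<open>
  Contracting with \<open>v\<close> in all arguments makes symmetrization invisible. One of the contractions
  turns the derivatives into the derivative of \<open>radon_test \<eta> v\<close> in direction \<open>v\<close>, which is zero.
\<close>

lemma radon_zero_symmetrize_nabla:
  fixes f h :: "'n::finite tensor"
  assumes m: "m \<ge> 1" and h: "tensor_in (m - 1) distributions h"
    and f: "tensor_eq m f (symmetrize m (nabla h))"
  shows "radon_zero m f"
  unfolding radon_zero_def
proof (intro ballI)
  fix v :: "real^'n" and \<eta> :: "real^'n \<Rightarrow> complex"
  assume "v \<in> int_lattice - {0}" and \<eta>: "\<eta> \<in> test_functions"
  then have v: "v \<in> int_lattice" by simp
  define g where "g = radon_test \<eta> v"
  have g: "g \<in> test_functions" unfolding g_def by (rule radon_test_test[OF \<eta>])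
  define P where "P I = complex_of_real (\<Prod>i\<leftarrow>I. v $ i)" for I
  define T where "T I = - h (tl I) (pdiff (hd I) g) * P I" for I
  obtain m' where m': "m = Suc m'" using m by (cases m) auto
  have "(\<Sum>I | length I = m. T I) = (\<Sum>J | length J = m'. \<Sum>i\<in>UNIV. T (i # J))"
    unfolding m' sum_lists_Suc by (rule sum.swap)
  also have "\<dots> = 0"
  proof (rule sum.neutral, rule ballI)
    fix J :: "'n list" assume "J \<in> {J. length J = m'}"
    then have hJ: "h J \<in> distributions" using h m' by (simp add: tensor_in_def)
    have "(\<Sum>i\<in>UNIV. T (i # J)) = - P J * (\<Sum>i\<in>UNIV. of_real (v $ i) * h J (pdiff i g))"
      by (simp add: T_def P_def sum_distrib_left sum_negf mult_ac)
    also have "(\<Sum>i\<in>UNIV. of_real (v $ i) * h J (pdiff i g)) =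
        h J (\<lambda>x. \<Sum>i\<in>UNIV. of_real (v $ i) * pdiff i g x)"
      using g by (subst distribution_sum[OF hJ]) (simp_all add: test_scale distribution_scale[OF hJ])
    also have "\<dots> = 0"
      unfolding g_def radon_test_deriv_along[OF \<eta> v] by (rule distribution_zero[OF hJ])
    finally show "(\<Sum>i\<in>UNIV. T (i # J)) = 0" by simp
  qed
  finally have T0: "(\<Sum>I | length I = m. T I) = 0" .
  have "radon m f v \<eta> = (\<Sum>I | length I = m. symmetrize m (nabla h) I g * P I)"
    using f g by (simp add: radon_def tensor_apply_def g_def[symmetric] P_def tensor_eq_def)
  also have "\<dots> = (\<Sum>I | length I = m. (\<Sum>p | p permutes {..<m}. T (permute_list p I)) / fact m)"
  proof (intro sum.cong refl)
    fix I :: "'n list" assume "I \<in> {I. length I = m}"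
    then have "P (permute_list p I) = P I" if "p permutes {..<m}" for p
      unfolding P_def using that by (subst prod_list_permute_list) auto
    then have "(\<Sum>p | p permutes {..<m}. T (permute_list p I)) =
        (\<Sum>p | p permutes {..<m}. nabla h (permute_list p I) g * P I)"
      by (intro sum.cong) (auto simp: T_def nabla_def distr_deriv_def)
    then show "symmetrize m (nabla h) I g * P I = (\<Sum>p | p permutes {..<m}. T (permute_list p I)) / fact m"
      by (simp add: symmetrize_def sum_distrib_right)
  qed
  also have "\<dots> = (\<Sum>p | p permutes {..<m}. \<Sum>I | length I = m. T (permute_list p I)) / fact m"
    unfolding sum_divide_distrib[symmetric] by (subst sum.swap) (rule refl)
  also have "\<dots> = 0" using T0 by (simp add: sum_permute_list)
  finally show "radon m f v \<eta> = 0" .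
qed

section \<open>Fourier coefficients of tensor fields\<close>

text \<open>
  Components at lists of other lengths are set to zero, since they are arbitrary in a tensor
  field but symmetry and bounds are used for all lists.
\<close>

definition tensor_fourier :: "nat \<Rightarrow> 'n::finite tensor \<Rightarrow> real^'n \<Rightarrow> 'n list \<Rightarrow> complex" where
  "tensor_fourier m f k I = (if length I = m then fourier_coeff (f I) k else 0)"

lemma perm_invariant_tensor_fourier:
  assumes "symmetric_tensor m f" and k: "k \<in> int_lattice"
  shows "perm_invariant (tensor_fourier m f k)"
  unfolding perm_invariant_def
proof (intro allI impI)
  fix I J :: "'a list" assume IJ: "mset I = mset J"
  then have len: "length I = length J" by (rule mset_eq_length)
  obtain p where p: "p permutes {..<length J}" "permute_list p J = I"
    by (rule mset_eq_permutation[OF IJ])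
  show "tensor_fourier m f k I = tensor_fourier m f k J"
  proof (cases "length J = m")
    case True
    have "f (permute_list p J) (torus_exp (- k)) = f J (torus_exp (- k))"
      using assms p(1) True by (simp add: symmetric_tensor_def tensor_eq_def)
    then show ?thesis
      using p(2) len by (simp add: tensor_fourier_def fourier_coeff_def)
  qed (simp add: tensor_fourier_def len)
qed

text \<open>
  The average of an exponential along lines orthogonal to its frequency is the exponential itself.
\<close>

lemma radon_torus_exp:
  assumes "k \<in> int_lattice" "v \<in> int_lattice" "k \<bullet> v = 0"
  shows "radon m f v (torus_exp (- k)) = (contract v ^^ m) (tensor_fourier m f k) []"
proof -
  have "radon_test (torus_exp (- k)) v = torus_exp (- k)"
    using assms by (simp add: radon_test_torus_exp)
  then show ?thesis
    by (simp add: radon_def tensor_apply_def contract_power_eq_sum tensor_fourier_def fourier_coeff_def)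
qed

lemma contractions_vanish:
  fixes f :: "'n::finite tensor"
  assumes m: "m \<ge> 1" and sym: "symmetric_tensor m f" and R: "radon_zero m f"
    and k: "k \<in> int_lattice" and ws: "length ws = m" "set ws \<subseteq> {v \<in> int_lattice. k \<bullet> v = 0}"
  shows "fold contract ws (tensor_fourier m f k) [] = 0"
proof (rule polarization[where M = "{v \<in> int_lattice. k \<bullet> v = 0}"])
  show "perm_invariant (tensor_fourier m f k)" by (rule perm_invariant_tensor_fourier[OF sym k])
  show "{v \<in> int_lattice. k \<bullet> v = 0} \<noteq> {}"
  proof -
    have "(0 :: real^'n) \<in> {v \<in> int_lattice. k \<bullet> v = 0}" by (simp add: int_lattice_def)
    then show ?thesis by blast
  qed
  fix v w :: "real^'n" and j :: nat
  assume v: "v \<in> {v \<in> int_lattice. k \<bullet> v = 0}"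
  \<comment> \<open>The zero vector lies in the lattice but gives no condition on the Radon transform;
    there the value is zero because there is at least one argument.\<close>
  show "(contract v ^^ length ws) (tensor_fourier m f k) [] = 0"
  proof (cases "v = 0")
    case True
    have "contract 0 F = (\<lambda>I. 0)" for F :: "'n list \<Rightarrow> complex" by (simp add: contract_def fun_eq_iff)
    then show ?thesis using True m ws(1) by (cases m) simp_all
  next
    case False
    then show ?thesis
      using v k R ws(1) radon_torus_exp[of k v m f] by (simp add: radon_zero_def)
  qed
  assume w: "w \<in> {v \<in> int_lattice. k \<bullet> v = 0}"
  show "v + real j *\<^sub>R w \<in> {v \<in> int_lattice. k \<bullet> v = 0}"
    using v w by (auto simp: int_lattice_def inner_add_right)
qed (use ws in auto)

lemma tangential_lattice:
  assumes "k \<in> int_lattice"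
  shows "tangential k i \<in> {v \<in> int_lattice. k \<bullet> v = 0}"
proof -
  have "(norm k)\<^sup>2 \<in> \<int>"
    using int_lattice_inner[OF assms assms] by (simp add: power2_norm_eq_inner)
  then have "tangential k i \<in> int_lattice"
    using assms by (auto simp: tangential_def int_lattice_def axis_def)
  moreover have "k \<bullet> tangential k i = 0"
    by (simp add: tangential_def inner_diff_right power2_norm_eq_inner)
  ultimately show ?thesis by simp
qed

lemma fold_contract_axis:
  "fold contract (map (\<lambda>i. axis i 1) I) F J = F (I @ J)"
  by (induction I arbitrary: F) (simp_all add: contract_axis)

text \<open>
  For \<open>k \<noteq> 0\<close> the vectors \<open>tangential k i\<close> belong to the lattice on which \<open>F\<close> vanishes. For \<open>k = 0\<close> the
  lattice contains the basis vectors, so that both sides are zero.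
\<close>

lemma tensor_fourier_eq_quotient:
  fixes f :: "'n::finite tensor"
  assumes m: "m \<ge> 1" and sym: "symmetric_tensor m f" and R: "radon_zero m f"
    and k: "k \<in> int_lattice" and I: "length I = m"
  shows "tensor_fourier m f k I = (\<Sum>p | p permutes {..<m}.
    of_real (k $ hd (permute_list p I)) * tensor_quotient m k (tensor_fourier m f k) (tl (permute_list p I))) / fact m"
proof (cases "k = 0")
  case True
  have "fold contract (map (\<lambda>i. axis i 1) I) (tensor_fourier m f k) [] = 0"
    using I True by (intro contractions_vanish[OF m sym R k]) auto
  then show ?thesis using True by (simp add: fold_contract_axis)
next
  case False
  show ?thesis
  proof (rule quotient_works[OF perm_invariant_tensor_fourier[OF sym k] False I])
    fix J :: "'n list" assume "length J = m"
    then have "fold contract (map (tangential k) J) (tensor_fourier m f k) [] = 0"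
      using tangential_lattice[OF k] by (intro contractions_vanish[OF m sym R k]) auto
    then show "contract_tangential k J (tensor_fourier m f k) [] = 0"
      by (simp add: fold_map o_def)
  qed
qed

lemma tensor_fourier_growth:
  fixes f :: "'n::finite tensor"
  assumes "tensor_in m distributions f"
  obtains C N where "\<forall>k\<in>int_lattice.
    (\<Sum>I | length I = m. norm (tensor_fourier m f k I)) \<le> C * (1 + (norm k)\<^sup>2) ^ N"
proof -
  have "\<exists>C N. \<forall>k\<in>int_lattice. norm (tensor_fourier m f k I) \<le> C * (1 + (norm k)\<^sup>2) ^ N" for I
  proof (cases "length I = m")
    case True
    then have "f I \<in> distributions" using assms by (simp add: tensor_in_def)
    then show ?thesis using True by (metis fourier_coeff_growth tensor_fourier_def)
  next
    case False
    then show ?thesis by (intro exI[of _ 0]) (simp add: tensor_fourier_def)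
  qed
  then obtain C N where CN:
    "\<And>I k. k \<in> int_lattice \<Longrightarrow> norm (tensor_fourier m f k I) \<le> C I * (1 + (norm k)\<^sup>2) ^ N I"
    by metis
  let ?L = "{I :: 'n list. length I = m}"
  let ?N = "\<Sum>I\<in>?L. N I"
  have "(\<Sum>I\<in>?L. norm (tensor_fourier m f k I)) \<le> (\<Sum>I\<in>?L. \<bar>C I\<bar>) * (1 + (norm k)\<^sup>2) ^ ?N"
    if k: "k \<in> int_lattice" for k
    unfolding sum_distrib_right
  proof (rule sum_mono)
    fix I :: "'n list" assume I: "I \<in> ?L"
    have "norm (tensor_fourier m f k I) \<le> \<bar>C I\<bar> * (1 + (norm k)\<^sup>2) ^ N I"
      by (rule order_trans[OF CN[OF k]]) (simp add: mult_right_mono)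
    also have "\<dots> \<le> \<bar>C I\<bar> * (1 + (norm k)\<^sup>2) ^ ?N"
      using I by (intro mult_left_mono power_increasing member_le_sum finite_lists_of_length) auto
    finally show "norm (tensor_fourier m f k I) \<le> \<bar>C I\<bar> * (1 + (norm k)\<^sup>2) ^ ?N" .
  qed
  then show ?thesis by (intro that) blast
qed

lemma fourier_coeff_distr_deriv:
  assumes "u \<in> distributions" "k \<in> int_lattice"
  shows "fourier_coeff (distr_deriv i u) k = freq (k $ i) * fourier_coeff u k"
proof -
  have 1: "pdiff i (torus_exp (- k)) = (\<lambda>x. (- freq (k $ i)) * torus_exp (- k) x)"
    by (simp add: pdiff_torus_exp)
  have 2: "u (\<lambda>x. (- freq (k $ i)) * torus_exp (- k) x) = (- freq (k $ i)) * u (torus_exp (- k))"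
    using assms(2) by (intro distribution_scale[OF assms(1)]) simp
  show ?thesis unfolding fourier_coeff_def distr_deriv_def 1 2 by simp
qed

lemma symmetrize_nabla_distribution:
  fixes h :: "'n::finite tensor"
  assumes h: "tensor_in (m - 1) distributions h" and I: "length I = m"
  shows "symmetrize m (nabla h) I \<in> distributions"
proof -
  have "nabla h (permute_list p I) \<in> distributions" for p
    using h I by (auto simp: nabla_def tensor_in_def intro: distr_deriv_distribution)
  then have "(\<lambda>\<phi>. \<Sum>p | p permutes {..<m}. nabla h (permute_list p I) \<phi>) \<in> distributions"
    by (intro distributions_sum)
  from distribution_lincomb[OF this this, of "1 / fact m" 0]
  show ?thesis by (simp add: symmetrize_def)
qed

section \<open>Sobolev regularity of the quotient\<close>

lemma summable_on_finite_sum: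
  fixes g :: "'a \<Rightarrow> 'b \<Rightarrow> real"
  assumes "\<And>a. a \<in> A \<Longrightarrow> g a summable_on S"
  shows "(\<lambda>x. \<Sum>a\<in>A. g a x) summable_on S"
  using assms by (induction A rule: infinite_finite_induct) (auto intro: summable_on_add)

text \<open>
  The factor \<open>1 / \<bar>k\<bar>\<close> compensates the additional weight \<open>1 + \<bar>k\<bar>\<^sup>2\<close> because \<open>\<bar>k\<bar> \<ge> 1\<close> for nonzero integer
  vectors, so that \<open>(1 + \<bar>k\<bar>\<^sup>2) / \<bar>k\<bar>\<^sup>2 \<le> 2\<close>. At \<open>k = 0\<close> the bound reads zero, by division by zero.
\<close>

lemma sobolev_gain:
  fixes u :: "'n::finite distr" and f :: "'n tensor"
  assumes u: "u \<in> distributions" and f: "tensor_in m (sobolev s) f"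
    and bound: "\<And>k. k \<in> int_lattice \<Longrightarrow>
      norm (fourier_coeff u k) \<le> C * (\<Sum>I | length I = m. norm (tensor_fourier m f k I)) / norm k"
  shows "u \<in> sobolev (s + 1)"
proof -
  let ?L = "{I :: 'n list. length I = m}"
  define w where "w k = 1 + (norm k)\<^sup>2" for k :: "real^'n"
  have w: "w k \<ge> 1" for k by (simp add: w_def)
  define B where "B k = (\<Sum>I\<in>?L. w k powr s * (norm (fourier_coeff (f I) k))\<^sup>2)" for k
  have B: "(\<lambda>k. 2 * C\<^sup>2 * card ?L * B k) summable_on int_lattice"
    unfolding B_def using f
    by (intro summable_on_cmult_right summable_on_finite_sum) (simp add: tensor_in_def sobolev_def w_def)
  have "w k powr (s + 1) * (norm (fourier_coeff u k))\<^sup>2 \<le> 2 * C\<^sup>2 * card ?L * B k"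
    if k: "k \<in> int_lattice" for k
  proof (cases "k = 0")
    case True
    then have "fourier_coeff u k = 0" using bound[OF k] by simp
    then show ?thesis by (simp add: B_def sum_nonneg)
  next
    case False
    let ?A = "\<Sum>I\<in>?L. norm (tensor_fourier m f k I)"
    have n1: "1 \<le> (norm k)\<^sup>2"
    proof -
      have "(norm k)\<^sup>2 \<in> \<int>"
        using int_lattice_inner[OF k k] by (simp add: power2_norm_eq_inner)
      moreover have "(norm k)\<^sup>2 \<noteq> 0" using False by simp
      ultimately show ?thesis using Ints_nonzero_abs_ge1[of "(norm k)\<^sup>2"] by simp
    qed
    have "(norm (fourier_coeff u k))\<^sup>2 \<le> (C * ?A / norm k)\<^sup>2"
      by (intro power_mono bound k) simp
    also have "\<dots> = C\<^sup>2 * ?A\<^sup>2 / (norm k)\<^sup>2"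
      by (simp add: power_mult_distrib power_divide)
    finally have "w k powr (s + 1) * (norm (fourier_coeff u k))\<^sup>2 \<le>
        w k powr (s + 1) * (C\<^sup>2 * ?A\<^sup>2 / (norm k)\<^sup>2)"
      by (rule mult_left_mono) simp
    also have "\<dots> = (w k / (norm k)\<^sup>2) * (C\<^sup>2 * w k powr s * ?A\<^sup>2)"
      using w[of k] by (simp add: powr_add)
    also have "\<dots> \<le> 2 * (C\<^sup>2 * w k powr s * ?A\<^sup>2)"
      using n1 False by (intro mult_right_mono) (auto simp: w_def divide_le_eq)
    also have "\<dots> \<le> 2 * (C\<^sup>2 * w k powr s * ((\<Sum>I\<in>?L. (norm (tensor_fourier m f k I))\<^sup>2) * card ?L))"
      by (intro mult_left_mono sum_squared_le_sum_of_squares) auto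
    also have "\<dots> = 2 * C\<^sup>2 * card ?L * B k"
      by (simp add: B_def tensor_fourier_def sum_distrib_left mult_ac)
    finally show ?thesis .
  qed
  then have "(\<lambda>k. w k powr (s + 1) * (norm (fourier_coeff u k))\<^sup>2) summable_on int_lattice"
    by (intro summable_on_comparison_test[OF B]) auto
  then show ?thesis using u by (simp add: sobolev_def w_def)
qed

section \<open>The kernel of the Radon transform\<close>

text \<open>
  The coefficients of \<open>h\<close> at \<open>k\<close> are the quotient of those of \<open>f\<close> by \<open>2\<pi>i k\<close>. The same \<open>h\<close> works for
  all Sobolev exponents.
\<close>

lemma radon_zero_imp_symmetrized_derivative:
  fixes f :: "'n::finite tensor"
  assumes m: "m \<ge> 1" and f: "tensor_in m distributions f" and sym: "symmetric_tensor m f"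
    and R: "radon_zero m f"
  obtains h where "tensor_in (m - 1) distributions h" "tensor_eq m f (symmetrize m (nabla h))"
    "\<And>s. tensor_in m (sobolev s) f \<Longrightarrow> tensor_in (m - 1) (sobolev (s + 1)) h"
proof -
  define C where "C = (\<Sum>j<m. real CARD('n) * (2 * real CARD('n)) ^ j)"
  have C: "C \<ge> 0" unfolding C_def by (intro sum_nonneg) auto
  define A where "A k = (\<Sum>I | length I = m. norm (tensor_fourier m f k I))" for k
  define a where "a J k = tensor_quotient m k (tensor_fourier m f k) J / freq 1" for J k
  have A: "norm (tensor_fourier m f k I) \<le> A k" for I k
  proof (cases "length I = m")
    case True
    then show ?thesis unfolding A_def by (intro member_le_sum finite_lists_of_length) auto
  qed (simp add: A_def tensor_fourier_def sum_nonneg)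
  have a_le: "norm (a J k) \<le> C * A k / norm k" if "length J = m - 1" for J k
  proof -
    have "norm (a J k) \<le> norm (tensor_quotient m k (tensor_fourier m f k) J)"
      using pi_ge_two by (simp add: a_def norm_divide norm_mult divide_le_eq mult_le_cancel_left1)
    also have "\<dots> \<le> C * A k / norm k"
      unfolding C_def by (rule norm_quotient_le[OF A m that])
    finally show ?thesis .
  qed
  obtain D N where D: "\<forall>k\<in>int_lattice. A k \<le> D * (1 + (norm k)\<^sup>2) ^ N"
    unfolding A_def by (rule tensor_fourier_growth[OF f])
  have "\<exists>u\<in>distributions. \<forall>k\<in>int_lattice. fourier_coeff u k = a J k" if J: "length J = m - 1" for J
  proof -
    have "norm (a J k) \<le> C * D * (1 + (norm k)\<^sup>2) ^ N" if k: "k \<in> int_lattice" for k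
    proof -
      have A0: "A k \<ge> 0" by (simp add: A_def sum_nonneg)
      have "C * A k / norm k \<le> C * A k"
      proof (cases "k = 0")
        case True
        then show ?thesis using C A0 by simp
      next
        case False
        have "(norm k)\<^sup>2 \<in> \<int>"
          using int_lattice_inner[OF k k] by (simp add: power2_norm_eq_inner)
        then have "1 \<le> (norm k)\<^sup>2" using False Ints_nonzero_abs_ge1[of "(norm k)\<^sup>2"] by simp
        then have "1 \<le> norm k" using power2_le_imp_le[of 1 "norm k"] by simp
        then have "C * A k * 1 \<le> C * A k * norm k"
          using C A0 by (intro mult_left_mono) auto
        then show ?thesis using False by (simp add: divide_le_eq)
      qed
      also have "\<dots> \<le> C * (D * (1 + (norm k)\<^sup>2) ^ N)"
        using C D k by (intro mult_left_mono) auto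
      finally show ?thesis using a_le[OF J, of k] by (simp add: mult.assoc)
    qed
    then show ?thesis using distribution_with_fourier_coeffs[of "a J"] by metis
  qed
  then obtain h where h: "\<And>J. length J = m - 1 \<Longrightarrow> h J \<in> distributions"
    "\<And>J k. length J = m - 1 \<Longrightarrow> k \<in> int_lattice \<Longrightarrow> fourier_coeff (h J) k = a J k"
    by metis
  have h_in: "tensor_in (m - 1) distributions h" using h(1) by (simp add: tensor_in_def)
  show ?thesis
  proof (rule that[OF h_in])
    show "tensor_eq m f (symmetrize m (nabla h))"
      unfolding tensor_eq_def
    proof (intro allI impI ballI)
      fix I :: "'n list" and \<phi> :: "real^'n \<Rightarrow> complex"
      assume I: "length I = m" and \<phi>: "\<phi> \<in> test_functions"
      show "f I \<phi> = symmetrize m (nabla h) I \<phi>"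
      proof (rule distribution_eq_if_fourier_coeffs_eq[OF _ symmetrize_nabla_distribution[OF h_in I] _ \<phi>])
        show "f I \<in> distributions" using f I by (simp add: tensor_in_def)
        fix k :: "real^'n" assume k: "k \<in> int_lattice"
        have "fourier_coeff (symmetrize m (nabla h) I) k =
            (\<Sum>p | p permutes {..<m}. fourier_coeff (nabla h (permute_list p I)) k) / fact m"
          by (simp add: fourier_coeff_def symmetrize_def)
        also have "\<dots> = (\<Sum>p | p permutes {..<m}. of_real (k $ hd (permute_list p I)) *
            tensor_quotient m k (tensor_fourier m f k) (tl (permute_list p I))) / fact m"
          using I k h by (simp add: nabla_def fourier_coeff_distr_deriv a_def)
        also have "\<dots> = tensor_fourier m f k I"
          by (rule tensor_fourier_eq_quotient[OF m sym R k I, symmetric])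
        also have "\<dots> = fourier_coeff (f I) k" using I by (simp add: tensor_fourier_def)
        finally show "fourier_coeff (f I) k = fourier_coeff (symmetrize m (nabla h) I) k" ..
      qed
    qed
  next
    fix s assume s: "tensor_in m (sobolev s) f"
    show "tensor_in (m - 1) (sobolev (s + 1)) h"
      unfolding tensor_in_def
    proof (intro allI impI)
      fix J :: "'n list" assume J: "length J = m - 1"
      show "h J \<in> sobolev (s + 1)"
        by (rule sobolev_gain[OF h(1)[OF J] s, of C]) (simp add: h(2)[OF J] a_le[OF J, unfolded A_def])
    qed
  qed
qed

theorem theorem7:
  fixes f :: "'n::finite tensor" and m :: nat
  assumes "CARD('n) \<ge> 2" and "m \<ge> 1"
    and "tensor_in m distributions f" and "symmetric_tensor m f"
  shows "(radon_zero m f \<longleftrightarrow>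
            (\<exists>h. tensor_in (m - 1) distributions h \<and> tensor_eq m f (symmetrize m (nabla h)))) \<and>
         (\<forall>s::real. tensor_in m (sobolev s) f \<and> radon_zero m f \<longrightarrow>
            (\<exists>h. tensor_in (m - 1) (sobolev (s + 1)) h \<and>
                 tensor_eq m f (symmetrize m (nabla h))))"
proof -
  have "\<exists>h. tensor_in (m - 1) distributions h \<and> tensor_eq m f (symmetrize m (nabla h)) \<and>
      (\<forall>s. tensor_in m (sobolev s) f \<longrightarrow> tensor_in (m - 1) (sobolev (s + 1)) h)"
    if "radon_zero m f"
    by (rule radon_zero_imp_symmetrized_derivative[OF assms(2-4) that]) blast
  moreover have "radon_zero m f"
    if "tensor_in (m - 1) distributions h \<and> tensor_eq m f (symmetrize m (nabla h))" for h
    using radon_zero_symmetrize_nabla[OF assms(2)] that by blast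
  ultimately show ?thesis by blast
qed

end
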